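(* Let $N$ be a positive integer and $0<p<\infty$ with $pN>1$. Then the class $\mathfrak{w}_N$ is dense in $H^p(T_\Gamma)$, where $\mathfrak{w}_N$ is the family of functions $f\in H^p(T_\Gamma)$ such that (i) $f$ is infinitely differentiable on the closure $\overline{T_\Gamma}$, and (ii) $|z|^Nf(z)\to0$ as $|z|\to\infty$ in $\overline{T_\Gamma}$, where $|z|\to\infty$ means $z_j\to\infty$ for every $1\le j\le n$.
   Context: $\Gamma=\{y\in\mathbb{R}^n: y_j>0,\ j=1,\dots,n\}$ is the first octant and $T_\Gamma=\{x+iy: x\in\mathbb{R}^n,y\in\Gamma\}$. $H^p(T_\Gamma)$ is the space of holomorphic $F$ on $T_\Gamma$ with $\|F\|_{H^p}=\sup_{y\in\Gamma}\left(\int_{\mathbb{R}^n}|F(x+iy)|^p\,dx\right)^{1/p}<\infty$, with density in the (quasi-)metric $\|F-G\|_{H^p}$. *)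

theory Defs
  imports "HOL-Analysis.Analysis"
begin

definition tube :: "(complex ^ 'n) set" where
  "tube = {z. \<forall>j. Im (z $ j) > 0}"

definition tube_closure :: "(complex ^ 'n) set" where
  "tube_closure = {z. \<forall>j. Im (z $ j) \<ge> 0}"

definition octant :: "(real ^ 'n) set" where
  "octant = {y. \<forall>j. y $ j > 0}"

definition cpt :: "real ^ 'n \<Rightarrow> real ^ 'n \<Rightarrow> complex ^ 'n" where
  "cpt x y = (\<chi> j. Complex (x $ j) (y $ j))"

definition holo_on :: "(complex ^ 'n \<Rightarrow> complex) \<Rightarrow> (complex ^ 'n) set \<Rightarrow> bool" where
  "holo_on F S \<longleftrightarrow> (\<forall>z\<in>S. \<exists>L. (F has_derivative L) (at z) \<and>
        (\<forall>c v. L (c *s v) = c * L v))"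

definition p_integral :: "real \<Rightarrow> (complex ^ 'n \<Rightarrow> complex) \<Rightarrow> real ^ 'n \<Rightarrow> ennreal" where
  "p_integral p F y = (\<integral>\<^sup>+ x. ennreal (norm (F (cpt x y)) powr p) \<partial>lborel)"

definition Hp_norm :: "real \<Rightarrow> (complex ^ 'n \<Rightarrow> complex) \<Rightarrow> ennreal" where
  "Hp_norm p F = (SUP y\<in>octant. (if p_integral p F y = \<infinity> then \<infinity>
        else ennreal (enn2real (p_integral p F y) powr (1 / p))))"

definition Hp :: "real \<Rightarrow> (complex ^ 'n \<Rightarrow> complex) set" where
  "Hp p = {F. holo_on F tube \<and> Hp_norm p F < \<infinity>}"

fun Ck_on :: "nat \<Rightarrow> ('a::real_normed_vector) set \<Rightarrow> ('a \<Rightarrow> 'b::real_normed_vector) \<Rightarrow> bool" where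
  "Ck_on 0 S f = continuous_on S f"
| "Ck_on (Suc k) S f = (continuous_on S f \<and> (\<exists>f'. (\<forall>z\<in>S. (f has_derivative f' z) (at z within S))
        \<and> (\<forall>v. Ck_on k S (\<lambda>z. f' z v))))"

definition smooth_on :: "('a::real_normed_vector) set \<Rightarrow> ('a \<Rightarrow> 'b::real_normed_vector) \<Rightarrow> bool" where
  "smooth_on S f \<longleftrightarrow> (\<forall>k. Ck_on k S f)"

definition at_infty_tube :: "(complex ^ 'n) filter" where
  "at_infty_tube = inf (INF j. filtercomap (\<lambda>z. norm (z $ j)) at_top) (principal tube_closure)"

definition wN :: "real \<Rightarrow> nat \<Rightarrow> (complex ^ 'n \<Rightarrow> complex) set" where
  "wN p N = {f \<in> Hp p. smooth_on tube_closure f \<and>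
        ((\<lambda>z. norm z ^ N * norm (f z)) \<longlongrightarrow> 0) at_infty_tube}"

end

theory Submission
  imports Defs "HOL-Complex_Analysis.Complex_Analysis" "HOL-Real_Asymp.Real_Asymp"
begin

text \<open>
  The approximant is \<open>G z = F (z + c) * W (z + c)\<close>, where \<open>c\<close> is a small point of the tube and \<open>W\<close> is a product of powers
  of \<open>\<i> / (r * z\<^sub>j + \<i>)\<close> with \<open>r\<close> small. All of the work lies in choosing \<open>c\<close> such that \<open>F (\<cdot> + c)\<close> is close to \<open>F\<close> in
  \<open>H\<^sup>p\<close>; this is done for all \<open>0 < p < \<infinity>\<close> without boundary values or maximal functions.

  In one variable, the defect in the sub-mean value inequality for \<open>|f|\<^sup>p\<close> on a circle controls the oscillation of \<open>f\<close>:
  the mean of \<open>|f - f(0)|\<^sup>p\<close> is at most \<open>\<eta>\<close> times the mean of \<open>|f|\<^sup>p\<close> plus \<open>C\<^sub>\<eta>\<close> times the defect. One divides out a finite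
  Blaschke product and writes the zero-free factor as an \<open>m\<close>-th power with \<open>p * m \<ge> 2\<close>, so that the convexity of \<open>|h|\<^bsup>pm\<^esup>\<close>
  applies. Transplanting this to the half-planes \<open>x + i y + \<lambda> v\<close> (\<open>Im \<lambda> > 0\<close>) and integrating over \<open>x\<close> shows first that
  \<open>J(y) = \<integral> |F(x + i y)|\<^sup>p dx\<close> decreases in every coordinate of \<open>y\<close>, and then that the averaged \<open>L\<^sup>p\<close>-distance between
  \<open>F(\<cdot> + i y + m v)\<close>, \<open>m\<close> real, and \<open>F(\<cdot> + i (y + v))\<close> is controlled by \<open>\<eta> sup J + C\<^sub>\<eta> (sup J - J(y + v))\<close>. This is small when
  \<open>y\<close> and \<open>v\<close> are close to \<open>0\<close>, and by Fatou's lemma one real shift \<open>m\<close> is good for all \<open>y\<close> at once.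
\<close>

text \<open>For \<open>p < 1\<close> there is no Poisson representation to differentiate or average,
  and without boundary values the continuity of translations in \<open>L^p\<close> of the boundary
  cannot be invoked. Monotone convergence of \<open>J\<close> takes its place: a step from height
  \<open>y\<close> to \<open>y + v\<close> near the vertex of the octant costs almost nothing in the
  slice integral, and a function that nearly attains equality in the sub-mean value inequality has
  little room to oscillate. What this controls is an average over horizontal displacements. No
  prescribed displacement, 0 in particular, is controlled individually; but real translations
  preserve every slice integral, so a good displacement can be absorbed into the real part of
  \<open>c\<close>. Monotonicity is used a second time for differences of translates of
  \<open>F\<close>, which lie in \<open>H^p\<close> again: a bound along heights shrinking to 0 is a
  bound at all heights. It also shapes the approximant. Since \<open>F * W\<close> is formed before
  the shift by \<open>c\<close>, the damping error has to be small at one height only, where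
  dominated convergence applies.\<close>

no_notation fps_nth (infixl "$" 75)

section \<open>Mean oscillation of holomorphic functions on a circle\<close>

definition circ :: "real \<Rightarrow> complex" where
  "circ t = cis (2 * pi * t)"

definition cmean :: "(complex \<Rightarrow> real) \<Rightarrow> real" where
  "cmean u = integral {0..1} (\<lambda>t. u (circ t))"

lemma norm_circ [simp]: "norm (circ t) = 1"
  by (simp add: circ_def)

lemma continuous_on_circ [continuous_intros]: "continuous_on S circ"
  unfolding circ_def by (intro continuous_intros)

lemma continuous_on_comp_circ:
  assumes "continuous_on (sphere 0 1) u"
  shows "continuous_on S (\<lambda>t. u (circ t))"
  by (rule continuous_on_compose2[OF assms continuous_on_circ]) auto

lemma integrable_circ:
  assumes "continuous_on (sphere 0 1) (u :: complex \<Rightarrow> real)"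
  shows "(\<lambda>t. u (circ t)) integrable_on {0..1}"
  by (intro integrable_continuous_real continuous_on_comp_circ assms)

text \<open>Cauchy's formula at the centre. Only continuity is asked on the circle, since the inner
  factor in the Blaschke argument is handled with no more than that.\<close>

lemma has_integral_circ:
  assumes "continuous_on (cball 0 1) f" "f holomorphic_on ball 0 1"
  shows "((\<lambda>t. f (circ t)) has_integral f 0) {0..1}"
proof -
  have "((\<lambda>u. f u/(u-0)) has_contour_integral (2 * of_real pi * \<i> * f 0)) (circlepath 0 1)"
    by (rule Cauchy_integral_circlepath[OF assms]) simp
  then have "((\<lambda>t. f (circlepath 0 1 t) / circlepath 0 1 t * vector_derivative (circlepath 0 1) (at t within {0..1}))
     has_integral (2 * of_real pi * \<i> * f 0)) {0..1}"
    by (simp add: has_contour_integral_def)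
  then have "((\<lambda>t. (2 * of_real pi * \<i>) * f (circ t)) has_integral (2 * of_real pi * \<i> * f 0)) {0..1}"
    by (rule has_integral_eq[rotated])
       (simp add: vector_derivative_circlepath01, simp add: circlepath circ_def cis_conv_exp mult_ac)
  from has_integral_mult_right[OF this, of "1 / (2 * of_real pi * \<i>)"] show ?thesis
    by (simp add: field_simps)
qed

lemma cmean_Re:
  assumes "continuous_on (cball 0 1) f" "f holomorphic_on ball 0 1"
  shows "cmean (\<lambda>z. Re (f z)) = Re (f 0)"
  unfolding cmean_def
  using has_integral_linear[OF has_integral_circ[OF assms] bounded_linear_Re]
  by (simp add: o_def integral_unique)

lemma cmean_mono:
  assumes "continuous_on (sphere 0 1) u" "continuous_on (sphere 0 1) v"
    and "\<And>z. norm z = 1 \<Longrightarrow> u z \<le> v z"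
  shows "cmean u \<le> cmean v"
  unfolding cmean_def by (intro integral_le integrable_circ assms) auto

lemma cmean_add:
  assumes "continuous_on (sphere 0 1) u" "continuous_on (sphere 0 1) v"
  shows "cmean (\<lambda>z. u z + v z) = cmean u + cmean v"
  unfolding cmean_def by (intro integral_add integrable_circ assms)

lemma cmean_diff:
  assumes "continuous_on (sphere 0 1) u" "continuous_on (sphere 0 1) v"
  shows "cmean (\<lambda>z. u z - v z) = cmean u - cmean v"
  unfolding cmean_def by (intro integral_diff integrable_circ assms)

lemma cmean_cmult [simp]: "cmean (\<lambda>z. c * u z) = c * cmean u"
  unfolding cmean_def by simp

lemma cmean_const [simp]: "cmean (\<lambda>z. c) = c"
  unfolding cmean_def by simp

lemma cmean_cong: "(\<And>z. norm z = 1 \<Longrightarrow> u z = v z) \<Longrightarrow> cmean u = cmean v"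
  unfolding cmean_def by (rule integral_cong) simp

section \<open>Convexity of powers and zero-free functions on the disc\<close>

lemma powr_ge_tangent:
  fixes x q :: real
  assumes "x \<ge> 0" "q \<ge> 1"
  shows "x powr q \<ge> 1 + q * (x - 1)"
proof (cases "x = 0")
  case False
  then have x: "x > 0" using assms by simp
  have "1 + q * (x - 1) \<le> x powr q"
  proof (cases "1 + q * (x - 1) > 0")
    case True
    have "(1 + q * (x - 1)) powr (1/q) \<le> x"
    proof -
      \<comment> \<open>Weighted arithmetic-geometric mean inequality for
        \<open>1 + q * (x - 1)\<close> and \<open>1\<close> with weights \<open>1/q\<close> and
        \<open>1 - 1/q\<close>; the weighted arithmetic mean is exactly \<open>x\<close>.\<close>
      have "((1 + q * (x - 1)) powr (1/q)) * (1 powr (1 - 1/q)) \<le> (1/q) * (1 + q*(x-1)) + (1 - 1/q) * 1"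
        using True assms by (intro Youngs_inequality_0) (auto simp: field_simps)
      then show ?thesis using assms by (simp add: field_simps)
    qed
    then have "((1 + q * (x - 1)) powr (1/q)) powr q \<le> x powr q"
      using assms by (intro powr_mono2) auto
    then show ?thesis using assms True by (simp add: powr_powr)
  qed (use powr_ge_zero[of x q] in linarith)
  then show ?thesis .
qed (use assms in auto)

text \<open>The right-hand side is the convexity defect of \<open>\<lambda>h. norm h powr P\<close> at \<open>1\<close>.\<close>

lemma power_diff_le_convexity_defect:
  fixes p \<eta> :: real
  assumes p: "p > 0" and P: "p * real m \<ge> 2" and eta: "\<eta> > 0"
  shows "\<exists>C\<ge>0. \<forall>h::complex. norm (h ^ m - 1) powr p
           \<le> \<eta> + C * (norm h powr (p * m) - 1 - p * m * (Re h - 1))"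
proof -
  define P where "P = p * real m"
  define E where "E h = norm h powr P - 1 - P * (Re h - 1)" for h :: complex
  have P2: "P \<ge> 2" using P by (simp add: P_def)
  \<comment> \<open>Tangent inequality with exponent \<open>P/2 \<ge> 1\<close> at the point
    \<open>(norm h)^2\<close>. Since
    \<open>(norm h)^2 - 1 = (norm (h-1))^2 + 2 * (Re h - 1)\<close>, the linear term cancels and a
    quadratic lower bound is left.\<close>
  have E_ge: "E h \<ge> (P/2) * (norm (h-1))^2" for h
  proof -
    have "((norm h)^2) powr (P/2) \<ge> 1 + (P/2) * ((norm h)^2 - 1)"
      by (rule powr_ge_tangent) (use P2 in auto)
    moreover have "((norm h)^2) powr (P/2) = norm h powr P"
    proof (cases "h = 0")
      case False
      then have "(norm h)^2 = norm h powr 2" by simp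
      then show ?thesis by (simp only: powr_powr) simp
    qed (use P2 in auto)
    moreover have "(norm h)^2 = (norm (h-1))^2 + 2 * (Re h - 1) + 1"
      unfolding cmod_power2 by (simp add: power2_eq_square algebra_simps)
    ultimately show ?thesis by (simp add: E_def algebra_simps)
  qed
  have E0: "E h \<ge> 0" for h
  proof -
    have "0 \<le> (P/2) * (norm (h-1))^2" using P2 by simp
    then show ?thesis using E_ge[of h] by linarith
  qed
  \<comment> \<open>Chosen so that \<open>2 * (1 + P * (norm h + 1)) \<le> R * norm h \<le> norm h
    powr P\<close> for \<open>norm h \<ge> R\<close>; the linear part of \<open>E\<close> then costs
    at most half of the power.\<close>
  define R where "R = 2 * (1 + 2 * P)"
  have R1: "R \<ge> 10" using P2 by (simp add: R_def)
  have big: "norm h powr P \<le> 2 * E h" if "norm h \<ge> R" for h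
  proof -
    have "norm h ^ 2 \<le> norm h powr P"
      using that R1 powr_mono[of 2 P "norm h"] P2 by simp
    moreover have "R * norm h \<le> norm h ^ 2"
      using that by (simp add: power2_eq_square mult_right_mono)
    moreover have "2 * (1 + P * (norm h + 1)) \<le> R * norm h"
    proof -
      have "1 + P \<le> (1 + P) * norm h" using that R1 P2 by simp
      then show ?thesis by (simp add: R_def algebra_simps)
    qed
    moreover have "P * (Re h - 1) \<le> P * norm h"
      using complex_Re_le_cmod[of h] P2 by (intro mult_left_mono) auto
    ultimately show ?thesis using P2 by (simp add: E_def algebra_simps)
  qed
  have "((\<lambda>h::complex. norm (h ^ m - 1) powr p) \<longlongrightarrow> norm (1 ^ m - 1 :: complex) powr p) (at 1)"
    using p by (auto intro!: tendsto_eq_intros)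
  then have "\<forall>\<^sub>F h in at (1::complex). norm (h ^ m - 1) powr p < \<eta>"
    using p eta by (intro order_tendstoD) auto
  then obtain d where d: "d > 0" "\<And>h::complex. h \<noteq> 1 \<Longrightarrow> dist h 1 < d \<Longrightarrow> norm (h ^ m - 1) powr p < \<eta>"
    by (auto simp: eventually_at)
  define C1 where "C1 = (R ^ m + 1) powr p / ((P/2) * d^2)"
  define C where "C = 2 * 2 powr p + C1"
  have C1: "C1 \<ge> 0" using P2 d by (simp add: C1_def)
  have "norm (h ^ m - 1) powr p \<le> \<eta> + C * E h" for h
  proof -
    \<comment> \<open>Far out, \<open>E\<close> dominates the power itself; in the middle region
      \<open>E\<close> is at least \<open>(P/2) * d^2\<close> while the left side is bounded; near
      \<open>1\<close> continuity gives \<open>\<eta>\<close> alone.\<close>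
    consider "norm h \<ge> R" | "norm h < R" "norm (h - 1) \<ge> d" | "norm (h - 1) < d" by force
    then show ?thesis
    proof cases
      case 1
      have "norm (h^m - 1) \<le> norm h ^ m + 1"
        by (metis norm_one norm_power norm_triangle_ineq4)
      moreover have "norm h ^ m \<ge> 1" using 1 R1 by simp
      ultimately have "norm (h^m - 1) \<le> 2 * norm h ^ m" by linarith
      then have "norm (h^m - 1) powr p \<le> (2 * norm h ^ m) powr p"
        using p by (intro powr_mono2) auto
      also have "\<dots> = 2 powr p * norm h powr P"
      proof -
        have "norm h ^ m = norm h powr real m" using 1 R1 by (subst powr_realpow) auto
        then show ?thesis by (simp add: powr_mult powr_powr P_def mult.commute)
      qed
      also have "\<dots> \<le> 2 powr p * (2 * E h)"
        using big[OF 1] by (intro mult_left_mono) auto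
      also have "\<dots> \<le> C * E h"
        using E0[of h] C1 by (simp add: C_def algebra_simps)
      finally show ?thesis using eta by linarith
    next
      case 2
      have "norm (h^m - 1) \<le> norm h ^ m + 1"
        by (metis norm_one norm_power norm_triangle_ineq4)
      also have "\<dots> \<le> R ^ m + 1" using 2 by (auto intro: power_mono)
      finally have "norm (h^m - 1) powr p \<le> (R ^ m + 1) powr p"
        using p by (intro powr_mono2) auto
      also have "\<dots> = C1 * ((P/2) * d^2)" using P2 d by (simp add: C1_def)
      also have "\<dots> \<le> C1 * E h"
      proof (intro mult_left_mono C1)
        have "(P/2) * d^2 \<le> (P/2) * norm (h-1)^2"
          using 2 d P2 by (intro mult_left_mono power_mono) auto
        then show "(P/2) * d^2 \<le> E h" using E_ge[of h] by linarith
      qed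
      also have "\<dots> \<le> C * E h" using E0[of h] by (simp add: C_def mult_right_mono)
      finally show ?thesis using eta by linarith
    next
      case 3
      have "C * E h \<ge> 0" using C1 E0[of h] by (simp add: C_def)
      then show ?thesis using d(2)[of h] 3 eta p by (cases "h = 1") (auto simp: dist_norm)
    qed
  qed
  moreover have "C \<ge> 0" using C1 by (simp add: C_def)
  ultimately show ?thesis unfolding E_def P_def by (intro exI[of _ C]) auto
qed

text \<open>With \<open>h\<close> an \<open>m\<close>-th root of \<open>f\<close> and
  \<open>k = h / h 0\<close>, the mean of \<open>Re k\<close> is 1, so the linear term of the
  convexity defect has mean 0. The mean defect of \<open>k\<close> is therefore exactly the sub-mean
  value defect of \<open>norm f powr p\<close> divided by \<open>norm (f 0) powr p\<close>.\<close>

lemma zero_free_mean_oscillation: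
  fixes p \<eta> :: real
  assumes p: "p > 0" and eta: "\<eta> > 0"
  shows "\<exists>C\<ge>0. \<forall>f R. R > 1 \<longrightarrow> f holomorphic_on ball 0 R \<longrightarrow> (\<forall>z\<in>ball 0 R. f z \<noteq> 0) \<longrightarrow>
      cmean (\<lambda>z. norm (f z - f 0) powr p) \<le> \<eta> * norm (f 0) powr p + C * (cmean (\<lambda>z. norm (f z) powr p) - norm (f 0) powr p)
      \<and> norm (f 0) powr p \<le> cmean (\<lambda>z. norm (f z) powr p)"
proof -
  obtain m :: nat where m: "real m \<ge> 2 / p" by (meson real_arch_simple)
  with p have P: "p * real m \<ge> 2" and m0: "m > 0" 
    by (auto simp: field_simps intro!: Nat.gr0I)
  define P where "P = p * real m"
  obtain C where C: "C \<ge> 0" "\<And>h::complex. norm (h ^ m - 1) powr p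
           \<le> \<eta> + C * (norm h powr P - 1 - P * (Re h - 1))"
    using power_diff_le_convexity_defect[OF p P eta] by (auto simp: P_def)
  have P2: "P \<ge> 2" using P by (simp add: P_def)
  have main: "cmean (\<lambda>z. norm (f z - f 0) powr p) \<le> \<eta> * norm (f 0) powr p + C * (cmean (\<lambda>z. norm (f z) powr p) - norm (f 0) powr p)
      \<and> norm (f 0) powr p \<le> cmean (\<lambda>z. norm (f z) powr p)"
    if R: "R > 1" and f: "f holomorphic_on ball 0 R" and nz: "\<forall>z\<in>ball 0 R. f z \<noteq> 0" for f R
  proof -
    obtain L where L: "L holomorphic_on ball 0 R" "\<And>z. z \<in> ball 0 R \<Longrightarrow> f z = exp (L z)"
      using holomorphic_logarithm_exists[OF convex_ball open_ball f] nz R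
      by (metis centre_in_ball less_trans zero_less_one)
    define h where "h z = exp (L z / of_nat m)" for z
    have h: "h holomorphic_on ball 0 R"
      unfolding h_def by (intro holomorphic_intros L) (use m0 in auto)
    have fh: "f z = h z ^ m" if "z \<in> ball 0 R" for z
      using L(2)[OF that] m0 by (simp add: h_def exp_of_nat_mult[symmetric])
    have sub: "cball 0 1 \<subseteq> ball (0::complex) R" "sphere 0 1 \<subseteq> ball (0::complex) R" "0 \<in> ball (0::complex) R" using R by auto
    have h0: "h z \<noteq> 0" for z by (simp add: h_def)
    have hc: "continuous_on (cball 0 1) h" "continuous_on (sphere 0 1) h"
      using holomorphic_on_imp_continuous_on[OF h] sub continuous_on_subset by blast+
    have fc: "continuous_on (sphere 0 1) f"
      using holomorphic_on_imp_continuous_on[OF f] sub continuous_on_subset by blast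
    define k where "k z = h z / h 0" for z
    have kc: "continuous_on (cball 0 1) k" "continuous_on (sphere 0 1) k" "k holomorphic_on ball 0 1"
      unfolding k_def using h0 R
      by (auto intro!: continuous_intros hc holomorphic_intros holomorphic_on_subset[OF h])
    have kk: "cmean (\<lambda>z. Re (k z)) = 1"
      using cmean_Re[OF kc(1,3)] h0 by (simp add: k_def)
    have nf: "norm (f z) powr p = norm (k z) powr P * norm (f 0) powr p"
      if "z \<in> ball 0 R" for z
    proof -
      have "f z = k z ^ m * f 0" using fh[OF that] fh[OF sub(3)] h0 by (simp add: k_def power_divide)
      moreover have "(norm (k z) ^ m) powr p = norm (k z) powr P"
        using h0 by (simp add: k_def P_def powr_realpow[symmetric] powr_powr mult.commute)
      ultimately show ?thesis by (simp add: norm_mult powr_mult norm_power)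
    qed
    define E where "E z = norm (k z) powr P - 1 - P * (Re (k z) - 1)" for z
    have cE: "continuous_on (sphere 0 1) E" unfolding E_def
      by (intro continuous_intros kc) (use h0 in \<open>auto simp: k_def\<close>)
    have ckP: "continuous_on (sphere 0 1) (\<lambda>z. norm (k z) powr P)"
      by (intro continuous_intros kc) (use h0 in \<open>auto simp: k_def\<close>)
    have Ek: "cmean E = cmean (\<lambda>z. norm (k z) powr P) - 1"
    proof -
      have "cmean E = cmean (\<lambda>z. (norm (k z) powr P) - (1 + P * (Re (k z) - 1)))"
        unfolding E_def by (simp add: algebra_simps)
      also have "\<dots> = cmean (\<lambda>z. norm (k z) powr P) - cmean (\<lambda>z. 1 + P * (Re (k z) - 1))"
        by (intro cmean_diff ckP continuous_intros kc)
      also have "cmean (\<lambda>z. 1 + P * (Re (k z) - 1)) = 1 + P * cmean (\<lambda>z. Re (k z) - 1)"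
        by (subst cmean_add) (auto intro!: continuous_intros kc)
      also have "cmean (\<lambda>z. Re (k z) - 1) = 0"
        by (subst cmean_diff) (auto intro!: continuous_intros kc simp: kk)
      finally show ?thesis by simp
    qed
    have mf: "cmean (\<lambda>z. norm (f z) powr p) = norm (f 0) powr p * cmean (\<lambda>z. norm (k z) powr P)"
    proof -
      have "cmean (\<lambda>z. norm (f z) powr p) = cmean (\<lambda>z. norm (f 0) powr p * norm (k z) powr P)"
        by (rule cmean_cong, subst nf) (use R in \<open>auto simp: mult.commute\<close>)
      then show ?thesis by simp
    qed
    have E0: "E z \<ge> 0" for z
    proof -
      have "(norm (k z)) powr P \<ge> 1 + P * (norm (k z) - 1)"
        using P2 by (intro powr_ge_tangent) auto
      moreover have "P * (Re (k z) - 1) \<le> P * (norm (k z) - 1)"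
        using complex_Re_le_cmod[of "k z"] P2 by (intro mult_left_mono) auto
      ultimately show ?thesis by (simp add: E_def)
    qed
    have "0 \<le> cmean E" using cmean_mono[of "\<lambda>_. 0" E] E0 cE by simp
    then have 2: "norm (f 0) powr p \<le> cmean (\<lambda>z. norm (f z) powr p)"
      using mult_left_mono[of 1 "cmean (\<lambda>z. norm (k z) powr P)" "norm (f 0) powr p"] Ek mf by simp
    have "cmean (\<lambda>z. norm (f z - f 0) powr p) \<le> cmean (\<lambda>z. norm (f 0) powr p * (\<eta> + C * E z))"
    proof (rule cmean_mono)
      show "continuous_on (sphere 0 1) (\<lambda>z. norm (f z - f 0) powr p)"
        using p by (intro continuous_on_powr' continuous_intros fc) auto
      show "continuous_on (sphere 0 1) (\<lambda>z. norm (f 0) powr p * (\<eta> + C * E z))"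
        by (intro continuous_on_mult continuous_on_add continuous_on_const cE)
      fix z :: complex assume z: "norm z = 1"
      have "f z - f 0 = f 0 * (k z ^ m - 1)"
        using fh[of z] fh[OF sub(3)] h0 z R by (simp add: k_def power_divide algebra_simps)
      then have "norm (f z - f 0) powr p = norm (f 0) powr p * norm (k z ^ m - 1) powr p"
        by (simp add: norm_mult powr_mult)
      also have "\<dots> \<le> norm (f 0) powr p * (\<eta> + C * E z)"
        using C(2)[of "k z"] by (intro mult_left_mono) (auto simp: E_def)
      finally show "norm (f z - f 0) powr p \<le> norm (f 0) powr p * (\<eta> + C * E z)" .
    qed
    also have "\<dots> = norm (f 0) powr p * (\<eta> + C * cmean E)"
      by (simp add: cmean_add cE continuous_intros)
    also have "\<dots> = \<eta> * norm (f 0) powr p + C * (cmean (\<lambda>z. norm (f z) powr p) - norm (f 0) powr p)"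
      unfolding mf Ek by (simp add: algebra_simps)
    finally show ?thesis using 2 by simp
  qed
  then show ?thesis using C(1) by (intro exI[of _ C]) blast
qed

lemma cmean_dilate_continuous:
  fixes u :: "complex \<Rightarrow> real"
  assumes "continuous_on (cball 0 1) u"
  shows "continuous_on {0..1} (\<lambda>r. cmean (\<lambda>z. u (of_real r * z)))"
proof -
  have "continuous_on ({0..1} \<times> cbox 0 1) (\<lambda>(r, t). u (of_real r * circ t))"
    unfolding split_def
    by (rule continuous_on_compose2[OF assms])
       (auto intro!: continuous_intros continuous_on_compose2[OF continuous_on_circ] simp: norm_mult)
  from integral_continuous_on_param[OF this] show ?thesis
    by (simp add: cmean_def)
qed

lemma zero_free_mean_oscillation_closed:
  fixes p \<eta> :: real
  assumes p: "p > 0" and eta: "\<eta> > 0"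
  shows "\<exists>C\<ge>0. \<forall>f. continuous_on (cball 0 1) f \<longrightarrow> f holomorphic_on ball 0 1 \<longrightarrow> (\<forall>z\<in>ball 0 1. f z \<noteq> 0) \<longrightarrow>
      cmean (\<lambda>z. norm (f z - f 0) powr p) \<le> \<eta> * norm (f 0) powr p + C * (cmean (\<lambda>z. norm (f z) powr p) - norm (f 0) powr p)
      \<and> norm (f 0) powr p \<le> cmean (\<lambda>z. norm (f z) powr p)"
proof -
  obtain C where C: "C \<ge> 0" and *: "\<And>f R. R > 1 \<Longrightarrow> f holomorphic_on ball 0 R \<Longrightarrow> (\<forall>z\<in>ball 0 R. f z \<noteq> 0) \<Longrightarrow>
      cmean (\<lambda>z. norm (f z - f 0) powr p) \<le> \<eta> * norm (f 0) powr p + C * (cmean (\<lambda>z. norm (f z) powr p) - norm (f 0) powr p)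
      \<and> norm (f 0) powr p \<le> cmean (\<lambda>z. norm (f z) powr p)"
    using zero_free_mean_oscillation[OF p eta] by metis
  have "cmean (\<lambda>z. norm (f z - f 0) powr p) \<le> \<eta> * norm (f 0) powr p + C * (cmean (\<lambda>z. norm (f z) powr p) - norm (f 0) powr p)
      \<and> norm (f 0) powr p \<le> cmean (\<lambda>z. norm (f z) powr p)"
    if cf: "continuous_on (cball 0 1) f" and hf: "f holomorphic_on ball 0 1" and nz: "\<forall>z\<in>ball 0 1. f z \<noteq> 0" for f
  proof -
    define a where "a r = cmean (\<lambda>z. norm (f (of_real r * z) - f 0) powr p)" for r
    define b where "b r = cmean (\<lambda>z. norm (f (of_real r * z)) powr p)" for r
    have ca: "continuous_on {0..1} a" unfolding a_def
      by (rule cmean_dilate_continuous) (use p in \<open>intro continuous_on_powr' continuous_intros cf, auto\<close>)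
    have cb: "continuous_on {0..1} b" unfolding b_def
      by (rule cmean_dilate_continuous) (use p in \<open>intro continuous_on_powr' continuous_intros cf, auto\<close>)
    have r: "a r \<le> \<eta> * norm (f 0) powr p + C * (b r - norm (f 0) powr p) \<and> norm (f 0) powr p \<le> b r"
      if "r \<in> {0<..<1}" for r
    proof -
      have m: "of_real r * z \<in> ball (0::complex) 1" if "z \<in> ball 0 (1/r)" for z
        using that \<open>r \<in> _\<close> by (auto simp: norm_mult field_simps)
      show ?thesis using *[of "1/r" "\<lambda>z. f (of_real r * z)"] that nz m unfolding a_def b_def
        by (force intro!: holomorphic_on_compose_gen[OF _ hf, unfolded o_def] holomorphic_intros)
    qed
    have cl: "closure {0<..<1::real} = {0..1}" by (simp add: closure_greaterThanLessThan)
    have "\<eta> * norm (f 0) powr p + C * (b 1 - norm (f 0) powr p) - a 1 \<ge> 0"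
      by (rule continuous_ge_on_closure[where S="{0<..<1}"])
         (use r in \<open>auto simp: cl intro!: continuous_on_add continuous_on_diff continuous_on_mult continuous_on_const ca cb\<close>)
    moreover have "b 1 \<ge> norm (f 0) powr p"
      by (rule continuous_ge_on_closure[where S="{0<..<1}"]) (use r in \<open>auto simp: cl cb\<close>)
    ultimately show ?thesis by (simp add: a_def b_def)
  qed
  then show ?thesis using C by blast
qed

section \<open>Blaschke products and functions with zeros\<close>

lemma blaschke_factorization:
  assumes "finite {z\<in>ball 0 1. f z = 0}" "continuous_on (cball 0 1) f" "f holomorphic_on ball 0 1" "f 0 \<noteq> 0"
  shows "\<exists>B g. continuous_on (cball 0 1) B \<and> B holomorphic_on ball 0 1 \<and>
     continuous_on (cball 0 1) g \<and> g holomorphic_on ball 0 1 \<and>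
     (\<forall>z\<in>cball 0 1. f z = B z * g z) \<and> (\<forall>z\<in>sphere 0 1. norm (B z) = 1) \<and> (\<forall>z\<in>ball 0 1. g z \<noteq> (0::complex))"
  using assms
\<comment> \<open>The induction counts distinct zeros: each step removes one zero \<open>a\<close>
  with its full multiplicity \<open>k\<close>, so the zero set loses exactly one point.
  \<open>f 0 \<noteq> 0\<close> excludes the zero function and is inherited by the quotient.\<close>
proof (induction "card {z\<in>ball 0 1. f z = 0}" arbitrary: f)
  case 0
  then have "{z\<in>ball 0 1. f z = 0} = {}" by simp
  then show ?case using 0 by (intro exI[of _ "\<lambda>_. 1"] exI[of _ f]) auto
next
  case (Suc n)
  then obtain a where a: "a \<in> ball 0 1" "f a = 0"
    by (metis (mono_tags, lifting) Collect_empty_eq card.empty nat.distinct(1))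
  have nc: "\<not> f constant_on ball 0 1"
    using a Suc.prems(4) unfolding constant_on_def by (metis centre_in_ball zero_less_one)
  obtain g r k where g: "0 < k" "0 < r" "ball a r \<subseteq> ball 0 1" "g holomorphic_on ball a r"
     "\<And>w. w \<in> ball a r \<Longrightarrow> f w = (w - a)^k * g w" "\<And>w. w \<in> ball a r \<Longrightarrow> g w \<noteq> 0"
    using holomorphic_factor_zero_nonconstant[OF Suc.prems(3) open_ball connected_ball a nc] by metis
  \<comment> \<open>The removable singularity at \<open>a\<close> is filled with the value of the
    local factor \<open>g\<close>; elsewhere this is plain division, which keeps the continuity up
    to the circle.\<close>
  define G where "G z = (if z = a then g a else f z / (z - a)^k)" for z
  have Gg: "G z = g z" if "z \<in> ball a r" for z using g(5)[OF that] by (auto simp: G_def)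
  have hG1: "G holomorphic_on ball a r" using g(4) Gg holomorphic_cong by metis
  have hG2: "G holomorphic_on (ball 0 1 - {a})"
  proof -
    have "(\<lambda>z. f z / (z - a)^k) holomorphic_on (ball 0 1 - {a})"
      by (intro holomorphic_intros holomorphic_on_subset[OF Suc.prems(3)]) auto
    then show ?thesis by (rule holomorphic_transform) (auto simp: G_def)
  qed
  have "G holomorphic_on (ball 0 1 - {a}) \<union> ball a r"
    by (rule holomorphic_on_Un[OF hG2 hG1]) (auto intro: open_delete)
  moreover have "(ball 0 1 - {a}) \<union> ball a r = ball 0 1" using g a by auto
  ultimately have hG: "G holomorphic_on ball 0 1" by simp
  have cG: "continuous_on (cball 0 1) G"
    unfolding continuous_on_eq_continuous_within
  proof
    fix z :: complex assume z: "z \<in> cball 0 1"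
    show "continuous (at z within cball 0 1) G"
    proof (cases "z = a")
      case True
      have "continuous (at a) G"
        using hG1 g(2) by (metis centre_in_ball continuous_on_eq_continuous_at holomorphic_on_imp_continuous_on open_ball)
      then show ?thesis using True continuous_at_imp_continuous_at_within by blast
    next
      case False
      have "continuous (at z within cball 0 1) (\<lambda>z. f z / (z - a)^k)"
        using False z Suc.prems(2) by (intro continuous_intros) (auto simp: continuous_on_eq_continuous_within)
      then show ?thesis
        by (rule continuous_transform_within[where \<delta>="dist z a"]) (use False z in \<open>auto simp: G_def dist_commute\<close>)
    qed
  qed
  have nz: "1 - cnj a * z \<noteq> 0" if "z \<in> cball 0 1" for z
  proof
    assume "1 - cnj a * z = 0"
    then have "norm (cnj a * z) = 1" by simp
    moreover have "norm (cnj a * z) \<le> norm a * 1"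
      using that by (simp only: norm_mult complex_mod_cnj) (intro mult_left_mono, auto)
    ultimately show False using a by simp
  qed
  \<comment> \<open>Multiplying by the denominators of the Blaschke factor \<open>b\<close> gives
    \<open>f = b * G1\<close>. They do not vanish on the closed disc, so no zeros are added.\<close>
  define G1 where "G1 z = G z * (1 - cnj a * z)^k" for z
  define b where "b z = ((z - a) / (1 - cnj a * z))^k" for z
  have fb: "f z = b z * G1 z" if "z \<in> cball 0 1" for z
    using nz[OF that] a g(1) by (auto simp: b_def G1_def G_def power_divide)
  have zeros: "{z\<in>ball 0 1. G1 z = 0} = {z\<in>ball 0 1. f z = 0} - {a}"
    using nz g(2) g(6)[of a] by (auto simp: G1_def G_def)
  have G10: "G1 0 \<noteq> 0" using Suc.prems(4) fb[of 0] by auto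
  have "\<exists>B g. continuous_on (cball 0 1) B \<and> B holomorphic_on ball 0 1 \<and>
     continuous_on (cball 0 1) g \<and> g holomorphic_on ball 0 1 \<and>
     (\<forall>z\<in>cball 0 1. G1 z = B z * g z) \<and> (\<forall>z\<in>sphere 0 1. norm (B z) = 1) \<and> (\<forall>z\<in>ball 0 1. g z \<noteq> 0)"
  proof (rule Suc.hyps(1))
    show "n = card {z\<in>ball 0 1. G1 z = 0}"
      unfolding zeros using Suc.hyps(2) Suc.prems(1) a by (subst card_Diff_singleton) auto
    show "finite {z\<in>ball 0 1. G1 z = 0}" unfolding zeros using Suc.prems(1) by simp
    show "continuous_on (cball 0 1) G1" unfolding G1_def by (intro continuous_intros cG)
    show "G1 holomorphic_on ball 0 1" unfolding G1_def by (intro holomorphic_intros hG)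
  qed (rule G10)
  then obtain B h where Bh: "continuous_on (cball 0 1) B" "B holomorphic_on ball 0 1"
     "continuous_on (cball 0 1) h" "h holomorphic_on ball 0 1"
     "\<forall>z\<in>cball 0 1. G1 z = B z * h z" "\<forall>z\<in>sphere 0 1. norm (B z) = 1" "\<forall>z\<in>ball 0 1. h z \<noteq> 0" by blast
  have "norm (b z) = 1" if "z \<in> sphere 0 1" for z
  proof -
    \<comment> \<open>On the circle \<open>cnj z\<close> is the inverse of \<open>z\<close>, so
      numerator and denominator of the Blaschke factor have the same modulus.\<close>
    have "z * cnj z = 1" using that by (simp add: complex_norm_square[symmetric])
    then have "1 - cnj a * z = z * cnj (z - a)" by (simp add: algebra_simps)
    then have "norm (1 - cnj a * z) = norm (z - a)"
      using that by (simp only: norm_mult complex_mod_cnj) simp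
    then show ?thesis using nz[of z] that by (auto simp: b_def norm_power norm_divide)
  qed
  moreover have "continuous_on (cball 0 1) b" unfolding b_def
    by (intro continuous_intros) (use nz in auto)
  moreover have "b holomorphic_on ball 0 1" unfolding b_def
    by (intro holomorphic_intros) (use nz in auto)
  ultimately show ?case using Bh fb
    by (intro exI[of _ "\<lambda>z. b z * B z"] exI[of _ h]) (auto intro!: continuous_intros holomorphic_intros simp: norm_mult)
qed

text \<open>A quasi-triangle inequality that covers \<open>p < 1\<close> and
  \<open>p \<ge> 1\<close> with one constant, from \<open>a + b \<le> 2 * max a b\<close>.\<close>

lemma powr_add_le:
  fixes a b p :: real
  assumes "a \<ge> 0" "b \<ge> 0" "p > 0"
  shows "(a + b) powr p \<le> 2 powr p * (a powr p + b powr p)"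
proof -
  have "(a + b) powr p \<le> (2 * max a b) powr p" using assms by (intro powr_mono2) auto
  also have "\<dots> = 2 powr p * max a b powr p" using assms by (simp add: powr_mult)
  also have "max a b powr p \<le> a powr p + b powr p" by (auto simp: max_def)
  finally show ?thesis by simp
qed

lemma norm_add_powr_le:
  fixes a b :: "'a::real_normed_vector"
  assumes "p > 0"
  shows "norm (a + b) powr p \<le> 2 powr p * (norm a powr p + norm b powr p)"
  by (rule order_trans[OF powr_mono2 powr_add_le]) (use assms norm_triangle_ineq in auto)

text \<open>For exponent 2 there is an identity: \<open>norm (B z) = 1\<close> on the circle and the
  mean value property give \<open>1 - (norm (B 0))^2\<close> as the mean of
  \<open>(norm (B z - B 0))^2\<close>. The exponent is then changed on both sides by elementary
  inequalities, \<open>pw\<close> for the oscillation and \<open>sq\<close> for the defect.\<close>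

lemma inner_function_mean_oscillation:
  fixes p \<eta> :: real
  assumes p: "p > 0" and eta: "\<eta> > 0"
  shows "\<exists>C\<ge>0. \<forall>B. continuous_on (cball 0 1) B \<longrightarrow> B holomorphic_on ball 0 1 \<longrightarrow> (\<forall>z\<in>sphere 0 1. norm (B z) = 1) \<longrightarrow>
      cmean (\<lambda>z. norm (B z - B 0) powr p) \<le> \<eta> + C * (1 - norm (B 0) powr p) \<and> norm (B 0) \<le> 1"
proof -
  \<comment> \<open>If \<open>x powr p > \<eta>\<close>, then
    \<open>x^2 \<ge> \<eta> powr (2/p)\<close>, while \<open>x \<le> 2\<close> bounds the left side
    by \<open>2 powr p\<close>; the constant is the quotient of the two.\<close>
  define C1 where "C1 = 2 powr p / \<eta> powr (2/p)"
  have pw: "x powr p \<le> \<eta> + C1 * x\<^sup>2" if x: "0 \<le> x" "x \<le> 2" for x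
  proof (cases "x powr p \<le> \<eta>")
    case True
    have "C1 * x\<^sup>2 \<ge> 0" by (simp add: C1_def)
    then show ?thesis using True by linarith
  next
    case False
    then have "\<eta> powr (2/p) \<le> (x powr p) powr (2/p)"
      using p eta by (intro powr_mono2) auto
    then have "\<eta> powr (2/p) \<le> x powr 2" using p by (simp add: powr_powr)
    moreover have "x \<noteq> 0" using False eta by auto
    ultimately have xx: "\<eta> powr (2/p) \<le> x\<^sup>2" using x by simp
    have "x powr p \<le> 2 powr p" using x p by (intro powr_mono2) auto
    also have "\<dots> = C1 * \<eta> powr (2/p)" using eta by (simp add: C1_def)
    also have "\<dots> \<le> C1 * x\<^sup>2" using xx by (intro mult_left_mono) (auto simp: C1_def)
    finally show ?thesis using eta by linarith
  qed
  \<comment> \<open>The value 1 serves \<open>p \<ge> 2\<close>, where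
    \<open>b powr p \<le> b^2\<close>; for smaller \<open>p\<close> the tangent of
    \<open>x powr (2/p)\<close> at 1 has slope \<open>2/p\<close>.\<close>
  define C2 where "C2 = max 1 (2/p)"
  have sq: "1 - b\<^sup>2 \<le> C2 * (1 - b powr p)" if b: "0 \<le> b" "b \<le> 1" for b
  proof -
    have b1: "b powr p \<le> 1" using b p by (simp add: powr_le1)
    show ?thesis
    proof (cases "p \<ge> 2")
      case True
      have "b powr p \<le> b\<^sup>2"
      proof (cases "b = 0")
        case False
        then show ?thesis using powr_mono'[of 2 p b] True b by simp
      qed simp
      moreover have "1 * (1 - b powr p) \<le> C2 * (1 - b powr p)"
        using b1 by (intro mult_right_mono) (auto simp: C2_def)
      ultimately show ?thesis by simp
    next
      case False
      have "(b powr p) powr (2/p) \<ge> 1 + (2/p) * (b powr p - 1)"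
        by (rule powr_ge_tangent) (use False p in \<open>auto simp: field_simps\<close>)
      moreover have "(b powr p) powr (2/p) = b\<^sup>2"
        using p b by (cases "b = 0") (auto simp: powr_powr)
      moreover have "(2/p) * (1 - b powr p) \<le> C2 * (1 - b powr p)"
        using b1 by (intro mult_right_mono) (auto simp: C2_def)
      moreover have "(2/p) * (b powr p - 1) = - ((2/p) * (1 - b powr p))"
        using p by (simp add: field_simps)
      ultimately show ?thesis by linarith
    qed
  qed
  have "cmean (\<lambda>z. norm (B z - B 0) powr p) \<le> \<eta> + C1 * C2 * (1 - norm (B 0) powr p) \<and> norm (B 0) \<le> 1"
    if cB: "continuous_on (cball 0 1) B" and hB: "B holomorphic_on ball 0 1" and B1: "\<forall>z\<in>sphere 0 1. norm (B z) = 1" for B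
  proof -
    have cB': "continuous_on (sphere 0 1) B"
      using cB by (rule continuous_on_subset) auto
    have "cmean (\<lambda>z. (norm (B z - B 0))\<^sup>2) = cmean (\<lambda>z. (1 + (norm (B 0))\<^sup>2) - 2 * Re (cnj (B 0) * B z))"
    proof (rule cmean_cong)
      fix z :: complex assume "norm z = 1"
      then have "(norm (B z))\<^sup>2 = 1" using B1 by simp
      then show "(norm (B z - B 0))\<^sup>2 = (1 + (norm (B 0))\<^sup>2) - 2 * Re (cnj (B 0) * B z)"
        unfolding cmod_power2 by (simp add: power2_eq_square algebra_simps)
    qed
    also have "\<dots> = (1 + (norm (B 0))\<^sup>2) - 2 * cmean (\<lambda>z. Re (cnj (B 0) * B z))"
      by (subst cmean_diff, (intro continuous_intros cB')+, simp only: cmean_const cmean_cmult)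
    also have "cmean (\<lambda>z. Re (cnj (B 0) * B z)) = Re (cnj (B 0) * B 0)"
      by (rule cmean_Re) (intro continuous_intros holomorphic_intros cB hB)+
    also have "Re (cnj (B 0) * B 0) = (norm (B 0))\<^sup>2"
      unfolding cmod_power2 by (simp add: power2_eq_square)
    finally have sqm: "cmean (\<lambda>z. (norm (B z - B 0))\<^sup>2) = 1 - (norm (B 0))\<^sup>2" by simp
    have "0 \<le> cmean (\<lambda>z. (norm (B z - B 0))\<^sup>2)"
      using cmean_mono[of "\<lambda>_. 0" "\<lambda>z. (norm (B z - B 0))\<^sup>2"] by (simp add: continuous_intros cB')
    then have "(norm (B 0))\<^sup>2 \<le> 1\<^sup>2" using sqm by simp
    then have B0: "norm (B 0) \<le> 1" by (simp add: abs_square_le_1)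
    have "cmean (\<lambda>z. norm (B z - B 0) powr p) \<le> cmean (\<lambda>z. \<eta> + C1 * (norm (B z - B 0))\<^sup>2)"
    proof (rule cmean_mono)
      show "continuous_on (sphere 0 1) (\<lambda>z. norm (B z - B 0) powr p)"
        using p by (intro continuous_on_powr' continuous_intros cB') auto
      show "continuous_on (sphere 0 1) (\<lambda>z. \<eta> + C1 * (norm (B z - B 0))\<^sup>2)"
        by (intro continuous_intros cB')
      show "norm (B z - B 0) powr p \<le> \<eta> + C1 * (norm (B z - B 0))\<^sup>2" if "norm z = 1" for z
      proof (rule pw)
        have "norm (B z) = 1" using that B1 by simp
        then show "norm (B z - B 0) \<le> 2" using B0 norm_triangle_ineq4[of "B z" "B 0"] by linarith
      qed simp
    qed
    also have "\<dots> = \<eta> + C1 * (1 - (norm (B 0))\<^sup>2)"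
      by (subst cmean_add) (auto intro!: continuous_intros cB' simp: sqm)
    also have "\<dots> \<le> \<eta> + C1 * (C2 * (1 - norm (B 0) powr p))"
      using sq[of "norm (B 0)"] B0 by (intro add_left_mono mult_left_mono) (auto simp: C1_def)
    finally show ?thesis using B0 by (simp add: mult.assoc)
  qed
  moreover have "C1 * C2 \<ge> 0" by (simp add: C1_def C2_def)
  ultimately show ?thesis by (intro exI[of _ "C1 * C2"]) blast
qed

text \<open>An almost-equality in the sub-mean value inequality for \<open>norm f powr p\<close> forces \<open>f\<close> to be almost constant
  on the circle.\<close>

lemma mean_oscillation:
  fixes p \<eta> :: real
  assumes p: "p > 0" and eta: "\<eta> > 0"
  shows "\<exists>C\<ge>0. \<forall>f R. R > 1 \<longrightarrow> f holomorphic_on ball 0 R \<longrightarrow>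
      cmean (\<lambda>z. norm (f z - f 0) powr p) \<le> \<eta> * cmean (\<lambda>z. norm (f z) powr p) + C * (cmean (\<lambda>z. norm (f z) powr p) - norm (f 0) powr p)
      \<and> norm (f 0) powr p \<le> cmean (\<lambda>z. norm (f z) powr p)"
proof -
  \<comment> \<open>The factor \<open>2 powr p\<close> pays for the quasi-triangle inequality, the 2
    for the two factors \<open>g\<close> and \<open>B\<close>, each of which contributes an
    \<open>\<eta>1\<close>.\<close>
  define \<eta>1 where "\<eta>1 = \<eta> / (2 * 2 powr p)"
  have eta1: "\<eta>1 > 0" using eta by (simp add: \<eta>1_def)
  obtain C1 where C1: "C1 \<ge> 0" and zf: "\<And>f. continuous_on (cball 0 1) f \<Longrightarrow> f holomorphic_on ball 0 1 \<Longrightarrow> (\<forall>z\<in>ball 0 1. f z \<noteq> 0) \<Longrightarrow>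
      cmean (\<lambda>z. norm (f z - f 0) powr p) \<le> \<eta>1 * norm (f 0) powr p + C1 * (cmean (\<lambda>z. norm (f z) powr p) - norm (f 0) powr p)
      \<and> norm (f 0) powr p \<le> cmean (\<lambda>z. norm (f z) powr p)"
    using zero_free_mean_oscillation_closed[OF p eta1] by metis
  obtain C2 where C2: "C2 \<ge> 0" and bl: "\<And>B. continuous_on (cball 0 1) B \<Longrightarrow> B holomorphic_on ball 0 1 \<Longrightarrow> (\<forall>z\<in>sphere 0 1. norm (B z) = 1) \<Longrightarrow>
      cmean (\<lambda>z. norm (B z - B 0) powr p) \<le> \<eta>1 + C2 * (1 - norm (B 0) powr p) \<and> norm (B 0) \<le> 1"
    using inner_function_mean_oscillation[OF p eta1] by metis
  define C where "C = 1 + 2 powr p * (C1 + C2)"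
  have "cmean (\<lambda>z. norm (f z - f 0) powr p) \<le> \<eta> * cmean (\<lambda>z. norm (f z) powr p) + C * (cmean (\<lambda>z. norm (f z) powr p) - norm (f 0) powr p)
      \<and> norm (f 0) powr p \<le> cmean (\<lambda>z. norm (f z) powr p)"
    if R: "R > 1" and hf: "f holomorphic_on ball 0 R" for f R
  proof -
    have cf: "continuous_on (cball 0 1) f" "continuous_on (sphere 0 1) f"
      using R by (auto intro!: continuous_on_subset[OF holomorphic_on_imp_continuous_on[OF hf]])
    have cfp: "continuous_on (sphere 0 1) (\<lambda>z. norm (f z) powr p)"
      using p by (intro continuous_on_powr' continuous_intros cf) auto
    define m where "m = cmean (\<lambda>z. norm (f z) powr p)"
    have m0: "m \<ge> 0"
      using cmean_mono[of "\<lambda>_. 0" "\<lambda>z. norm (f z) powr p"] cfp by (simp add: m_def)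
    show ?thesis
    proof (cases "f 0 = 0")
      case True
      \<comment> \<open>For \<open>f 0 = 0\<close> oscillation and defect both equal
        \<open>m\<close>; the summand 1 in \<open>C\<close> is there for this case.\<close>
      have "1 * m \<le> C * m" using C1 C2 m0 by (intro mult_right_mono) (auto simp: C_def)
      moreover have "\<eta> * m \<ge> 0" using eta m0 by simp
      ultimately show ?thesis using True m0 p by (simp add: m_def)
    next
      case False
      \<comment> \<open>Zeros cannot accumulate at the circle because \<open>f\<close> is
        holomorphic across it, unless \<open>f\<close> is constant, and then
        \<open>f 0 \<noteq> 0\<close> leaves no zeros.\<close>
      have "finite {z\<in>ball 0 1. f z = 0}"
      proof (cases "f constant_on ball 0 R")
        case True
        then have "f z \<noteq> 0" if "z \<in> ball 0 R" for z
          using that False R unfolding constant_on_def by (metis centre_in_ball less_trans zero_less_one)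
        then have "{z\<in>ball 0 1. f z = 0} = {}" using R by auto
        then show ?thesis by (simp only: finite.emptyI)
      next
        case nc: False
        have "finite {z\<in>cball 0 1. f z = 0}"
          by (rule holomorphic_compact_finite_zeros[OF hf]) (use R nc in auto)
        then show ?thesis by (rule rev_finite_subset) auto
      qed
      then obtain B g where Bg: "continuous_on (cball 0 1) B" "B holomorphic_on ball 0 1"
         "continuous_on (cball 0 1) g" "g holomorphic_on ball 0 1"
         "\<And>z. z\<in>cball 0 1 \<Longrightarrow> f z = B z * g z" "\<forall>z\<in>sphere 0 1. norm (B z) = 1" "\<forall>z\<in>ball 0 1. g z \<noteq> 0"
        using blaschke_factorization[of f] cf(1) False holomorphic_on_subset[OF hf, of "ball 0 1"] R by fastforce
      have cs: "continuous_on (sphere 0 1) B" "continuous_on (sphere 0 1) g"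
        using continuous_on_subset[OF Bg(1), of "sphere 0 1"] continuous_on_subset[OF Bg(3), of "sphere 0 1"] by auto
      have m: "m = cmean (\<lambda>z. norm (g z) powr p)" unfolding m_def
        by (rule cmean_cong) (use Bg(5,6) in \<open>simp add: norm_mult\<close>)
      have f0: "f 0 = B 0 * g 0" by (rule Bg(5)) simp
      define x where "x = norm (g 0) powr p"
      define y where "y = norm (B 0) powr p"
      have xy: "norm (f 0) powr p = x * y" by (simp add: f0 x_def y_def norm_mult powr_mult)
      note G = zf[OF Bg(3,4,7)]
      note BB = bl[OF Bg(1,2,6)]
      have x0: "x \<ge> 0" and y1: "y \<le> 1" and xm: "x \<le> m"
        using BB G p m by (auto simp: x_def y_def powr_le1)
      have "cmean (\<lambda>z. norm (f z - f 0) powr p) \<le> cmean (\<lambda>z. 2 powr p * (norm (g z - g 0) powr p + x * norm (B z - B 0) powr p))"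
      proof (rule cmean_mono)
        show "continuous_on (sphere 0 1) (\<lambda>z. norm (f z - f 0) powr p)"
          using p by (intro continuous_on_powr' continuous_intros cf) auto
        show "continuous_on (sphere 0 1) (\<lambda>z. 2 powr p * (norm (g z - g 0) powr p + x * norm (B z - B 0) powr p))"
          using p by (intro continuous_on_mult continuous_on_add continuous_on_const continuous_on_powr' continuous_on_norm
            continuous_on_diff cs) auto
        fix z :: complex assume z: "norm z = 1"
        \<comment> \<open>The splitting pairs the oscillation of \<open>g\<close> with the
          unimodular \<open>B z\<close>, and the oscillation of \<open>B\<close> with the constant
          \<open>g 0\<close>.\<close>
        then have "f z - f 0 = B z * (g z - g 0) + (B z - B 0) * g 0"
          using Bg(5)[of z] f0 by (simp add: algebra_simps)
        then have "norm (f z - f 0) powr p \<le> 2 powr p * (norm (B z * (g z - g 0)) powr p + norm ((B z - B 0) * g 0) powr p)"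
          using norm_add_powr_le[OF p] by metis
        also have "\<dots> = 2 powr p * (norm (g z - g 0) powr p + x * norm (B z - B 0) powr p)"
          using z Bg(6) by (simp add: norm_mult powr_mult x_def mult.commute)
        finally show "norm (f z - f 0) powr p \<le> 2 powr p * (norm (g z - g 0) powr p + x * norm (B z - B 0) powr p)" .
      qed
      also have "\<dots> = 2 powr p * (cmean (\<lambda>z. norm (g z - g 0) powr p) + x * cmean (\<lambda>z. norm (B z - B 0) powr p))"
        using p by (simp, subst cmean_add) (auto intro!: continuous_on_mult continuous_on_const continuous_on_powr' continuous_on_norm
            continuous_on_diff cs)
      also have "\<dots> \<le> 2 powr p * ((\<eta>1 * x + C1 * (m - x)) + x * (\<eta>1 + C2 * (1 - y)))"
        using G BB x0 unfolding m x_def y_def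
        by (intro mult_left_mono add_mono) auto
      also have "\<dots> = 2 * 2 powr p * \<eta>1 * x + 2 powr p * (C1 * (m - x) + C2 * (x - x * y))"
        by (simp add: algebra_simps)
      also have "2 * 2 powr p * \<eta>1 * x \<le> \<eta> * m" using eta xm by (simp add: \<eta>1_def)
      \<comment> \<open>The total defect \<open>m - x * y\<close> is the sum of \<open>m - x\<close>
        and \<open>x - x * y\<close>, both nonnegative, so each of them is bounded by the
        whole.\<close>
      also have "C1 * (m - x) + C2 * (x - x * y) \<le> C1 * (m - x * y) + C2 * (m - x * y)"
        using x0 y1 xm C1 C2 by (intro add_mono mult_left_mono) (auto simp: mult_left_le)
      finally have "cmean (\<lambda>z. norm (f z - f 0) powr p) \<le> \<eta> * m + 2 powr p * (C1 + C2) * (m - x * y)"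
        by (simp add: algebra_simps)
      moreover have "x * y \<le> m" using x0 y1 xm by (meson mult_left_le order_trans)
      ultimately show ?thesis unfolding xy m_def[symmetric] by (simp add: C_def algebra_simps)
    qed
  qed
  moreover have "C \<ge> 0" using C1 C2 by (simp add: C_def)
  ultimately show ?thesis by (intro exI[of _ C]) blast
qed

section \<open>Holomorphic functions of several variables\<close>

lemma norm_vector_smult:
  fixes v :: "complex ^ 'n"
  shows "norm (c *s v) = norm c * norm v"
  by (simp add: norm_vec_def L2_set_def norm_mult power_mult_distrib sum_distrib_left[symmetric] real_sqrt_mult)

lemma bounded_linear_smult_left: "bounded_linear (\<lambda>c. c *s (v :: complex ^ 'n))"
  by (rule bounded_linear_intro[where K="norm v"])
     (simp_all add: norm_vector_smult vec_eq_iff algebra_simps)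

lemma holo_on_has_derivative:
  assumes "holo_on F S" "z \<in> S"
  shows "(F has_derivative frechet_derivative F (at z)) (at z)"
    and "frechet_derivative F (at z) (c *s v) = c * frechet_derivative F (at z) v"
proof -
  obtain L where L: "(F has_derivative L) (at z)" "\<And>c v. L (c *s v) = c * L v"
    using assms unfolding holo_on_def by blast
  have "L = frechet_derivative F (at z)" using L(1) frechet_derivative_at by blast
  then show "(F has_derivative frechet_derivative F (at z)) (at z)"
    "frechet_derivative F (at z) (c *s v) = c * frechet_derivative F (at z) v"
    using L by auto
qed

lemma holo_onI:
  assumes "\<And>z. z \<in> S \<Longrightarrow> (F has_derivative L z) (at z)" "\<And>z c v. z \<in> S \<Longrightarrow> L z (c *s v) = c * L z v"
  shows "holo_on F S"
  using assms unfolding holo_on_def by blast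

lemma holo_on_subset: "holo_on F S \<Longrightarrow> T \<subseteq> S \<Longrightarrow> holo_on F T"
  unfolding holo_on_def by blast

lemma holo_on_imp_continuous_on: "holo_on F S \<Longrightarrow> continuous_on S F"
  by (meson continuous_at_imp_continuous_on has_derivative_continuous holo_on_has_derivative(1))

lemma holo_on_const [simp]: "holo_on (\<lambda>z. c) S"
  by (rule holo_onI[where L="\<lambda>_ _. 0"]) auto

lemma holo_on_component: "holo_on (\<lambda>z. z $ j) S"
  by (rule holo_onI[where L="\<lambda>_ z. z $ j"])
     (auto intro!: bounded_linear_imp_has_derivative bounded_linear_vec_nth)

lemma holo_on_add:
  assumes "holo_on F S" "holo_on G S" shows "holo_on (\<lambda>z. F z + G z) S"
  by (rule holo_onI[OF has_derivative_add[OF holo_on_has_derivative(1)[OF assms(1)] holo_on_has_derivative(1)[OF assms(2)]]])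
     (auto simp: holo_on_has_derivative(2)[OF assms(1)] holo_on_has_derivative(2)[OF assms(2)] algebra_simps)

lemma holo_on_mult:
  assumes "holo_on F S" "holo_on G S" shows "holo_on (\<lambda>z. F z * G z) S"
  by (rule holo_onI[OF has_derivative_mult[OF holo_on_has_derivative(1)[OF assms(1)] holo_on_has_derivative(1)[OF assms(2)]]])
     (auto simp: holo_on_has_derivative(2)[OF assms(1)] holo_on_has_derivative(2)[OF assms(2)] algebra_simps)

lemma holo_on_diff:
  assumes "holo_on F S" "holo_on G S" shows "holo_on (\<lambda>z. F z - G z) S"
  using holo_on_add[OF assms(1) holo_on_mult[OF holo_on_const[of "-1"] assms(2)]] by simp

lemma holo_on_power:
  assumes "holo_on F S" shows "holo_on (\<lambda>z. F z ^ k) S"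
  by (induction k) (auto intro: holo_on_mult assms)

lemma holo_on_prod:
  assumes "\<And>i. i \<in> I \<Longrightarrow> holo_on (F i) S" shows "holo_on (\<lambda>z. \<Prod>i\<in>I. F i z) S"
  using assms by (induction I rule: infinite_finite_induct) (auto intro: holo_on_mult)

lemma holo_on_compose_field:
  assumes F: "holo_on F S" and g: "g holomorphic_on T" "open T" and FT: "\<And>z. z \<in> S \<Longrightarrow> F z \<in> T"
  shows "holo_on (\<lambda>z. g (F z)) S"
proof (rule holo_onI)
  fix z assume z: "z \<in> S"
  have "(g has_field_derivative deriv g (F z)) (at (F z))"
    using g FT[OF z] holomorphic_derivI by blast
  then show "((\<lambda>z. g (F z)) has_derivative (\<lambda>h. deriv g (F z) * frechet_derivative F (at z) h)) (at z)"
    using has_derivative_compose[OF holo_on_has_derivative(1)[OF F z]] unfolding has_field_derivative_def by blast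
  show "deriv g (F z) * frechet_derivative F (at z) (c *s v) = c * (deriv g (F z) * frechet_derivative F (at z) v)" for c v
    by (simp add: holo_on_has_derivative(2)[OF F z])
qed

lemma has_derivative_translate:
  assumes "(F has_derivative L) (at (z + c))"
  shows "((\<lambda>z. F (z + c)) has_derivative L) (at z)"
proof -
  have "((\<lambda>z. z + c) has_derivative (\<lambda>h. h)) (at z)" by (auto intro!: derivative_eq_intros)
  from has_derivative_compose[OF this assms] show ?thesis .
qed

lemma holo_on_translate:
  assumes "holo_on F S" "\<And>z. z \<in> T \<Longrightarrow> z + c \<in> S"
  shows "holo_on (\<lambda>z. F (z + c)) T"
proof (rule holo_onI)
  fix z assume "z \<in> T"
  then have z: "z + c \<in> S" by (rule assms)
  show "((\<lambda>z. F (z + c)) has_derivative frechet_derivative F (at (z + c))) (at z)"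
    by (rule has_derivative_translate) (rule holo_on_has_derivative(1)[OF assms(1) z])
  show "frechet_derivative F (at (z + c)) (d *s v) = d * frechet_derivative F (at (z + c)) v" for d v
    by (rule holo_on_has_derivative(2)[OF assms(1) z])
qed

text \<open>Complex homogeneity makes the derivative along a complex line multiplication by a
  number, which opens the one-variable theory on every such line.\<close>

lemma holo_on_line_derivative:
  assumes F: "holo_on F S" and z: "z + l *s v \<in> S"
  shows "((\<lambda>l. F (z + l *s v)) has_field_derivative frechet_derivative F (at (z + l *s v)) v) (at l)"
proof -
  have "((\<lambda>l. z + l *s v) has_derivative (\<lambda>c. c *s v)) (at l)"
    by (auto intro!: derivative_eq_intros bounded_linear_imp_has_derivative bounded_linear_smult_left)
  from has_derivative_compose[OF this holo_on_has_derivative(1)[OF F z]] show ?thesis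
    by (simp add: has_field_derivative_def holo_on_has_derivative(2)[OF F z] mult.commute[of _ "frechet_derivative _ _ _"])
qed

lemma holo_on_line:
  assumes "holo_on F S" "\<And>l. l \<in> A \<Longrightarrow> z + l *s v \<in> S"
  shows "(\<lambda>l. F (z + l *s v)) holomorphic_on A"
  unfolding holomorphic_on_def field_differentiable_def
  using holo_on_line_derivative[OF assms(1) assms(2)] has_field_derivative_at_within by blast

section \<open>Cauchy estimates and smoothness of holomorphic functions\<close>

lemma holo_on_derivative_bound:
  assumes D: "holo_on D S" and r: "r > 0" "cball x r \<subseteq> S" and b: "\<And>z. z \<in> cball x r \<Longrightarrow> norm (D z) \<le> e"
  shows "norm (frechet_derivative D (at x) h) \<le> e / r * norm h"
proof (cases "h = 0")
  case True
  have "frechet_derivative D (at x) (0 *s h) = 0"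
    by (subst holo_on_has_derivative(2)[OF D]) (use r in auto)
  then show ?thesis using True by simp
next
  case False
  \<comment> \<open>Cauchy's inequality is applied on the complex line through \<open>x\<close> in
    direction \<open>h\<close>; parameters of modulus at most \<open>r / norm h\<close> stay inside
    \<open>cball x r\<close>.\<close>
  define s where "s = r / norm h"
  have s: "s > 0" using False r by (simp add: s_def)
  have mem: "x + l *s h \<in> cball x r" if "norm l \<le> s" for l
    using that False by (simp add: dist_norm norm_vector_smult s_def field_simps)
  define f where "f l = D (x + l *s h)" for l
  have hf: "f holomorphic_on cball 0 s" unfolding f_def
    by (rule holo_on_line[OF D]) (use mem r in auto)
  have "norm ((deriv ^^ 1) f 0) \<le> fact 1 * e / s ^ 1"
  proof (rule Cauchy_inequality)
    show "f holomorphic_on ball 0 s" "continuous_on (cball 0 s) f"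
      using hf holomorphic_on_subset[OF hf ball_subset_cball] holomorphic_on_imp_continuous_on by auto
    show "norm (f l) \<le> e" if "norm (0 - l) = s" for l
      using mem[of l] b that by (simp add: f_def)
  qed (rule s)
  moreover have "deriv f 0 = frechet_derivative D (at x) h"
  proof (rule DERIV_imp_deriv)
    have "x \<in> S" using r by auto
    then show "(f has_field_derivative frechet_derivative D (at x) h) (at 0)"
      using holo_on_line_derivative[OF D, of x 0 h] unfolding f_def by simp
  qed
  ultimately show ?thesis using False by (simp add: s_def)
qed

text \<open>First-order Taylor expansion, with the second derivative on \<open>ball 0 r\<close>
  bounded by Cauchy's inequality on discs of radius \<open>r\<close> inside
  \<open>ball 0 (2 * r)\<close>. The rate depends on \<open>f\<close> only through \<open>M\<close>,
  which later gives uniformity in the base point.\<close>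

lemma holomorphic_difference_quotient_bound:
  assumes f: "f holomorphic_on ball 0 (2 * r)" and r: "r > 0"
    and b: "\<And>z. z \<in> ball 0 (2 * r) \<Longrightarrow> norm (f z) \<le> M" and h: "h \<noteq> 0" "norm h < r"
  shows "norm ((f h - f 0) / h - deriv f 0) \<le> 2 * M / r\<^sup>2 * norm h"
proof -
  have "norm (f h - (\<Sum>i\<le>1. (deriv ^^ i) f 0 * (h - 0)^i / fact i)) \<le> 2 * M / r\<^sup>2 * norm (h - 0) ^ Suc 1 / fact 1"
  proof (rule complex_Taylor[of "ball 0 r" 1 "\<lambda>i. (deriv ^^ i) f", simplified funpow_0])
    fix i z assume z: "z \<in> ball (0::complex) r"
    have "((deriv ^^ i) f has_field_derivative deriv ((deriv ^^ i) f) z) (at z)"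
      by (rule holomorphic_derivI[of _ "ball 0 (2 * r)"]) (use z r f in \<open>auto intro: holomorphic_higher_deriv\<close>)
    then show "((deriv ^^ i) f has_field_derivative (deriv ^^ Suc i) f z) (at z within ball 0 r)"
      by (simp add: has_field_derivative_at_within)
  next
    fix z assume z: "z \<in> ball (0::complex) r"
    have sub: "cball z r \<subseteq> ball 0 (2 * r)"
    proof
      fix w assume "w \<in> cball z r"
      then show "w \<in> ball 0 (2 * r)"
        using z norm_triangle_ineq[of z "w - z"] by (auto simp: dist_norm norm_minus_commute)
    qed
    have "norm ((deriv ^^ 2) f z) \<le> fact 2 * M / r ^ 2"
    proof (rule Cauchy_inequality)
      show "f holomorphic_on ball z r" "continuous_on (cball z r) f"
        using holomorphic_on_subset[OF f] sub ball_subset_cball[of z r] holomorphic_on_imp_continuous_on[OF f] continuous_on_subset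
        by blast+
      show "norm (f w) \<le> M" if "norm (z - w) = r" for w
        by (rule b) (use sub that in \<open>auto simp: dist_norm\<close>)
    qed (rule r)
    then show "norm ((deriv ^^ Suc 1) f z) \<le> 2 * M / r\<^sup>2" by (simp add: numeral_2_eq_2)
  qed (use r h in auto)
  then have "norm (f h - f 0 - deriv f 0 * h) \<le> 2 * M / r\<^sup>2 * norm h * norm h"
    by (simp add: algebra_simps power2_eq_square)
  moreover have "f h - f 0 - deriv f 0 * h = ((f h - f 0) / h - deriv f 0) * h"
    using h by (simp add: field_simps)
  ultimately have "norm ((f h - f 0) / h - deriv f 0) * norm h \<le> (2 * M / r\<^sup>2 * norm h) * norm h"
    by (simp add: norm_mult)
  then show ?thesis using h mult_right_le_imp_le by (metis zero_less_norm_iff)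
qed

text \<open>Smoothness has to come from complex differentiability alone. The difference quotients in
  direction \<open>v\<close> are holomorphic and converge uniformly near \<open>z0\<close>; by
  Cauchy's inequality their derivatives converge uniformly on a smaller ball. Hence the limit is
  differentiable, and its derivative inherits complex homogeneity.\<close>

lemma holo_on_directional_derivative:
  fixes F :: "complex ^ 'n \<Rightarrow> complex"
  assumes F: "holo_on F S" and S: "open S"
  shows "holo_on (\<lambda>z. frechet_derivative F (at z) v) S"
  unfolding holo_on_def
proof
  fix z0 assume "z0 \<in> S"
  then obtain R where R: "R > 0" "cball z0 R \<subseteq> S" using S open_contains_cball by blast
  have "compact (F ` cball z0 R)"
    using holo_on_imp_continuous_on[OF F] R by (intro compact_continuous_image) (auto intro: continuous_on_subset)
  then obtain M where M: "\<And>z. z \<in> cball z0 R \<Longrightarrow> norm (F z) \<le> M"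
    using compact_imp_bounded[of "F ` cball z0 R"] unfolding bounded_iff by blast
  \<comment> \<open>Of the total radius \<open>4 * r\<close>, one half is reserved for the base
    point and one half for the displacement along \<open>v\<close>. The \<open>+ 1\<close> in
    \<open>\<rho>\<close> covers \<open>v = 0\<close>.\<close>
  define r where "r = R / 4"
  define \<rho> where "\<rho> = r / (norm v + 1)"
  have r: "r > 0" "R = 4 * r" using R by (auto simp: r_def)
  have nv: "norm v + 1 > 0" using norm_ge_zero[of v] by linarith
  have rho: "\<rho> > 0" using r nv by (simp add: \<rho>_def)
  have rv: "\<rho> * norm v \<le> r"
    using r nv by (simp add: \<rho>_def field_simps)
  have mem: "z + l *s v \<in> ball z0 R" if "z \<in> ball z0 (2 * r)" "norm l < 2 * \<rho>" for z l
  proof -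
    have "norm (l *s v) \<le> 2 * \<rho> * norm v"
      using that by (simp add: norm_vector_smult mult_right_mono)
    then have "norm (l *s v) \<le> 2 * r" using rv by linarith
    then show ?thesis using that norm_triangle_ineq[of "z - z0" "l *s v"] r
      by (auto simp: dist_norm norm_minus_commute algebra_simps)
  qed
  have M0: "M \<ge> 0" using M[of z0] R norm_ge_zero[of "F z0"] by (meson centre_in_cball less_imp_le order_trans)
  \<comment> \<open>The \<open>+ 2\<close> makes already the first increment strictly smaller than
    \<open>\<rho>\<close>.\<close>
  define h where "h n = complex_of_real (\<rho> / (real n + 2))" for n :: nat
  have h_norm: "norm (h n) = \<rho> / (real n + 2)" for n
    unfolding h_def norm_of_real using rho by simp
  have h: "h n \<noteq> 0" "norm (h n) < \<rho>" for n
  proof -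
    have "\<rho> / (real n + 2) > 0" "\<rho> / (real n + 2) < \<rho>" using rho by (auto simp: field_simps add_pos_nonneg)
    then show "h n \<noteq> 0" "norm (h n) < \<rho>" using h_norm[of n] by auto
  qed
  define Q where "Q n z = (F (z + h n *s v) - F z) / h n" for n z
  define \<epsilon> where "\<epsilon> n = 2 * M / \<rho>\<^sup>2 * norm (h n)" for n
  have eps: "\<epsilon> \<longlonglongrightarrow> 0"
  proof -
    have "(\<lambda>n. \<rho> / (real n + 2)) \<longlonglongrightarrow> 0" by real_asymp
    then have "(\<lambda>n. norm (h n)) \<longlonglongrightarrow> 0" by (simp add: h_norm)
    from tendsto_mult_left[OF this, of "2 * M / \<rho>\<^sup>2"] show ?thesis unfolding \<epsilon>_def by simp
  qed
  have Qb: "norm (Q n z - frechet_derivative F (at z) v) \<le> \<epsilon> n" if z: "z \<in> ball z0 (2 * r)" for n z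
  proof -
    define f where "f l = F (z + l *s v)" for l
    have hf: "f holomorphic_on ball 0 (2 * \<rho>)" unfolding f_def
      by (rule holo_on_line[OF F]) (use mem[OF z] R in \<open>fastforce simp: less_imp_le\<close>)
    have fb: "norm (f l) \<le> M" if "l \<in> ball 0 (2 * \<rho>)" for l
      unfolding f_def by (rule M) (use mem[OF z, of l] that in auto)
    have "deriv f 0 = frechet_derivative F (at z) v"
    proof (rule DERIV_imp_deriv)
      have "z \<in> S" using z R r by auto
      then show "(f has_field_derivative frechet_derivative F (at z) v) (at 0)"
        using holo_on_line_derivative[OF F, of z 0 v] unfolding f_def by simp
    qed
    with holomorphic_difference_quotient_bound[OF hf rho fb h, of n]
    have "norm ((f (h n) - f 0) / h n - frechet_derivative F (at z) v) \<le> \<epsilon> n" by (simp add: \<epsilon>_def)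
    then show ?thesis by (simp add: f_def Q_def)
  qed
  have QH: "holo_on (Q n) (ball z0 (2 * r))" for n
  proof -
    have "holo_on (\<lambda>z. F (z + h n *s v)) (ball z0 (2 * r))"
      by (rule holo_on_translate[OF F]) (use mem[of _ "h n"] h[of n] rho R in \<open>fastforce simp: less_imp_le\<close>)
    moreover have "holo_on F (ball z0 (2 * r))"
      by (rule holo_on_subset[OF F]) (use R r in auto)
    ultimately have "holo_on (\<lambda>z. (F (z + h n *s v) - F z) * (1 / h n)) (ball z0 (2 * r))"
      by (intro holo_on_mult holo_on_diff holo_on_const)
    then show ?thesis unfolding Q_def by simp
  qed
  define q where "q n x = frechet_derivative (Q n) (at x)" for n x
  define U where "U = ball z0 r"
  have Uin: "cball x (r/2) \<subseteq> ball z0 (2 * r)" if "x \<in> U" for x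
  proof
    fix w assume "w \<in> cball x (r/2)"
    then show "w \<in> ball z0 (2 * r)"
      using that r dist_triangle[of z0 w x] by (auto simp: U_def)
  qed
  \<comment> \<open>Cauchy's inequality for \<open>Q n - Q m\<close> on balls of radius
    \<open>r/2\<close> turns uniform closeness of the quotients into closeness of their
    derivatives.\<close>
  have qd: "norm (q n x w - q m x w) \<le> (\<epsilon> n + \<epsilon> m) * (2 / r) * norm w" if x: "x \<in> U" for n m x w
  proof -
    have D: "holo_on (\<lambda>z. Q n z - Q m z) (ball z0 (2 * r))" by (intro holo_on_diff QH)
    have xb: "x \<in> ball z0 (2 * r)" using x r by (auto simp: U_def)
    have "((\<lambda>z. Q n z - Q m z) has_derivative (\<lambda>w. q n x w - q m x w)) (at x)"
      unfolding q_def by (intro has_derivative_diff holo_on_has_derivative(1)[OF QH xb])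
    then have "frechet_derivative (\<lambda>z. Q n z - Q m z) (at x) = (\<lambda>w. q n x w - q m x w)"
      using frechet_derivative_at by metis
    moreover have "norm (frechet_derivative (\<lambda>z. Q n z - Q m z) (at x) w) \<le> (\<epsilon> n + \<epsilon> m) / (r/2) * norm w"
    proof (rule holo_on_derivative_bound[OF D _ Uin[OF x]])
      fix z assume "z \<in> cball x (r/2)"
      then have z: "z \<in> ball z0 (2 * r)" using Uin[OF x] by blast
      show "norm (Q n z - Q m z) \<le> \<epsilon> n + \<epsilon> m"
        using norm_triangle_ineq4[of "Q n z - frechet_derivative F (at z) v" "Q m z - frechet_derivative F (at z) v"]
          Qb[OF z, of n] Qb[OF z, of m] by simp
    qed (use r in auto)
    ultimately show ?thesis by (simp add: field_simps)
  qed
  have conv: "convergent (\<lambda>n. q n x w)" if x: "x \<in> U" for x w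
  proof (rule Cauchy_convergent, rule metric_CauchyI)
    fix e :: real assume e: "e > 0"
    define d where "d = e / (4 / r * norm w + 1)"
    have pos: "4 / r * norm w + 1 > 0" using r by (simp add: add_nonneg_pos)
    have d: "d > 0" using e pos by (simp add: d_def)
    obtain N where N: "\<And>n. n \<ge> N \<Longrightarrow> norm (\<epsilon> n) < d" using LIMSEQ_D[OF eps d] by auto
    have "dist (q n x w) (q m x w) < e" if nm: "n \<ge> N" "m \<ge> N" for n m
    proof -
      have "(\<epsilon> n + \<epsilon> m) * (2 / r) * norm w \<le> (d + d) * (2 / r) * norm w"
        using N[OF nm(1)] N[OF nm(2)] r by (intro mult_right_mono) auto
      also have "\<dots> = d * (4 / r * norm w)" by simp
      also have "\<dots> < d * (4 / r * norm w + 1)" using d by (intro mult_strict_left_mono) auto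
      also have "\<dots> = e" using pos by (simp add: d_def)
      finally show ?thesis using qd[OF x, of n w m] by (simp add: dist_norm)
    qed
    then show "\<exists>N. \<forall>m\<ge>N. \<forall>n\<ge>N. dist (q m x w) (q n x w) < e" by blast
  qed
  define g' where "g' x w = lim (\<lambda>n. q n x w)" for x w
  have qlim: "(\<lambda>n. q n x w) \<longlonglongrightarrow> g' x w" if "x \<in> U" for x w
    unfolding g'_def using conv[OF that] by (simp add: convergent_LIMSEQ_iff)
  have qg: "norm (q n x w - g' x w) \<le> \<epsilon> n * (2 / r) * norm w" if x: "x \<in> U" for n x w
  proof (rule LIMSEQ_le[of "\<lambda>m. norm (q n x w - q m x w)" _ "\<lambda>m. (\<epsilon> n + \<epsilon> m) * (2 / r) * norm w"])
    show "(\<lambda>m. norm (q n x w - q m x w)) \<longlonglongrightarrow> norm (q n x w - g' x w)"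
      by (intro tendsto_intros qlim x)
    have "(\<lambda>m. (\<epsilon> n + \<epsilon> m) * (2 / r) * norm w) \<longlonglongrightarrow> (\<epsilon> n + 0) * (2 / r) * norm w"
      by (intro tendsto_intros eps)
    then show "(\<lambda>m. (\<epsilon> n + \<epsilon> m) * (2 / r) * norm w) \<longlonglongrightarrow> \<epsilon> n * (2 / r) * norm w" by simp
  qed (use qd[OF x] in blast)
  have z0U: "z0 \<in> U" using r by (simp add: U_def)
  have UB: "U \<subseteq> ball z0 (2 * r)" using r by (auto simp: U_def)
  have Qlim: "(\<lambda>n. Q n z) \<longlonglongrightarrow> frechet_derivative F (at z) v" if "z \<in> U" for z
  proof (rule LIM_zero_cancel, rule Lim_null_comparison[OF _ eps])
    show "\<forall>\<^sub>F n in sequentially. norm (Q n z - frechet_derivative F (at z) v) \<le> \<epsilon> n"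
      by (intro always_eventually allI Qb) (use that UB in auto)
  qed
  have "\<exists>g. \<forall>x\<in>U. (\<lambda>n. Q n x) \<longlonglongrightarrow> g x \<and> (g has_derivative g' x) (at x within U)"
  proof (rule has_derivative_sequence[where f=Q and f'=q and g'=g' and S=U, OF _ _ _ z0U Qlim[OF z0U]])
    show "convex U" by (simp add: U_def)
    show "(Q n has_derivative q n x) (at x within U)" if "x \<in> U" for n x
      unfolding q_def
      by (rule has_derivative_at_withinI, rule holo_on_has_derivative(1)[OF QH]) (use that UB in auto)
    fix e :: real assume e: "e > 0"
    have "\<forall>\<^sub>F n in sequentially. \<epsilon> n < e * r / 2"
      using order_tendstoD(2)[OF eps, of "e * r / 2"] e r by simp
    then show "\<forall>\<^sub>F n in sequentially. \<forall>x\<in>U. \<forall>w. norm (q n x w - g' x w) \<le> e * norm w"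
    proof (rule eventually_mono, intro ballI allI)
      fix n x and w :: "complex ^ 'n" assume n: "\<epsilon> n < e * r / 2" and x: "x \<in> U"
      have "\<epsilon> n * (2 / r) \<le> e" using n r by (simp add: field_simps)
      then have "\<epsilon> n * (2 / r) * norm w \<le> e * norm w" by (intro mult_right_mono) auto
      then show "norm (q n x w - g' x w) \<le> e * norm w" using qg[OF x, of n w] by linarith
    qed
  qed
  then obtain g where g: "\<And>x. x \<in> U \<Longrightarrow> (\<lambda>n. Q n x) \<longlonglongrightarrow> g x" "\<And>x. x \<in> U \<Longrightarrow> (g has_derivative g' x) (at x within U)"
    by blast
  have gF: "g x = frechet_derivative F (at x) v" if "x \<in> U" for x
    using LIMSEQ_unique[OF g(1)[OF that] Qlim[OF that]] .
  have "(g has_derivative g' z0) (at z0)"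
    using g(2)[OF z0U] at_within_open[OF z0U] by (simp add: U_def)
  then have "((\<lambda>z. frechet_derivative F (at z) v) has_derivative g' z0) (at z0)"
    by (rule has_derivative_transform_within_open[OF _ _ z0U]) (auto simp: gF U_def)
  moreover have "g' z0 (c *s w) = c * g' z0 w" for c w
  proof (rule LIMSEQ_unique[OF qlim[OF z0U]])
    have "q n z0 (c *s w) = c * q n z0 w" for n
      unfolding q_def by (rule holo_on_has_derivative(2)[OF QH]) (use z0U UB in auto)
    then show "(\<lambda>n. q n z0 (c *s w)) \<longlonglongrightarrow> c * g' z0 w"
      using tendsto_mult_left[OF qlim[OF z0U, of w], of c] by simp
  qed
  ultimately show "\<exists>L. ((\<lambda>z. frechet_derivative F (at z) v) has_derivative L) (at z0) \<and> (\<forall>c w. L (c *s w) = c * L w)"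
    by blast
qed

text \<open>The induction generalises over \<open>F\<close>, since the next level concerns the
  directional derivatives. Holomorphy on an open superset allows any \<open>T\<close>, in particular
  a closed one, with derivatives taken within \<open>T\<close>.\<close>

lemma holo_on_imp_Ck_on:
  assumes "holo_on F S" "open S" "T \<subseteq> S"
  shows "Ck_on k T F"
  using assms
proof (induction k arbitrary: F)
  case 0
  then show ?case using continuous_on_subset[OF holo_on_imp_continuous_on] by simp
next
  case (Suc k)
  have "(F has_derivative frechet_derivative F (at z)) (at z within T)" if "z \<in> T" for z
    using holo_on_has_derivative(1)[OF Suc.prems(1), of z] that Suc.prems(3) has_derivative_at_withinI by blast
  moreover have "Ck_on k T (\<lambda>z. frechet_derivative F (at z) v)" for v
    by (rule Suc.IH[OF holo_on_directional_derivative]) (use Suc.prems in auto)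
  moreover have "continuous_on T F"
    using holo_on_imp_continuous_on[OF Suc.prems(1)] Suc.prems(3) by (rule continuous_on_subset)
  ultimately show ?case
    unfolding Ck_on.simps by (intro conjI exI[of _ "\<lambda>z. frechet_derivative F (at z)"]) auto
qed

lemma holo_on_imp_smooth_on: "holo_on F S \<Longrightarrow> open S \<Longrightarrow> T \<subseteq> S \<Longrightarrow> smooth_on T F"
  by (simp add: smooth_on_def holo_on_imp_Ck_on)

section \<open>Integration over the tube\<close>

lemma continuous_on_norm_powr:
  fixes f :: "'a::topological_space \<Rightarrow> 'b::real_normed_vector"
  assumes "continuous_on S f" "p > 0"
  shows "continuous_on S (\<lambda>z. norm (f z) powr p)"
  using assms by (intro continuous_on_powr' continuous_intros) auto

lemma cpt_nth [simp]: "cpt x y $ j = Complex (x $ j) (y $ j)"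
  by (simp add: cpt_def)

lemma cpt_add: "cpt x y + cpt u w = cpt (x + u) (y + w)"
  by (simp add: vec_eq_iff complex_eq_iff)

lemma smult_cpt: "c *s cpt u w = cpt (Re c *\<^sub>R u - Im c *\<^sub>R w) (Im c *\<^sub>R u + Re c *\<^sub>R w)"
  by (simp add: vec_eq_iff complex_eq_iff algebra_simps)

lemma cpt_Re_Im: "z = cpt (\<chi> j. Re (z $ j)) (\<chi> j. Im (z $ j))"
  by (simp add: vec_eq_iff complex_eq_iff)

lemma cpt_in_tube [simp]: "cpt x y \<in> tube \<longleftrightarrow> y \<in> octant"
  by (simp add: tube_def octant_def)

lemma continuous_on_cpt [continuous_intros]:
  "continuous_on S f \<Longrightarrow> continuous_on S g \<Longrightarrow> continuous_on S (\<lambda>x. cpt (f x) (g x))"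
  unfolding cpt_def by (intro continuous_on_vec_lambda continuous_on_Complex continuous_intros)

lemma continuous_on_smult [continuous_intros]:
  fixes f :: "'a::topological_space \<Rightarrow> complex" and g :: "'a \<Rightarrow> complex ^ 'n"
  assumes "continuous_on S f" "continuous_on S g"
  shows "continuous_on S (\<lambda>x. f x *s g x)"
  unfolding vector_scalar_mult_def by (intro continuous_on_vec_lambda continuous_intros assms)

lemma open_tube: "open (tube :: (complex ^ 'n) set)"
proof -
  have "tube = (\<Inter>j. {z :: complex ^ 'n. 0 < Im (z $ j)})" by (auto simp: tube_def)
  moreover have "open (\<Inter>j. {z :: complex ^ 'n. 0 < Im (z $ j)})"
    by (intro open_INT finite ballI open_Collect_less continuous_intros)
  ultimately show ?thesis by (simp only:)
qed

lemma borel_measurable_cpt [measurable (raw)]: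
  fixes f g :: "'a \<Rightarrow> real ^ 'n"
  assumes "f \<in> borel_measurable M" "g \<in> borel_measurable M"
  shows "(\<lambda>x. cpt (f x) (g x)) \<in> borel_measurable M"
  by (rule borel_measurable_continuous_Pair[OF assms]) (intro continuous_intros)

lemma borel_measurable_smult [measurable (raw)]:
  fixes g :: "'a \<Rightarrow> complex ^ 'n"
  assumes "f \<in> borel_measurable M" "g \<in> borel_measurable M"
  shows "(\<lambda>x. f x *s g x) \<in> borel_measurable M"
  by (rule borel_measurable_continuous_Pair[OF assms]) (intro continuous_intros)

lemma borel_measurable_circ [measurable]: "circ \<in> borel_measurable borel"
  by (intro borel_measurable_continuous_onI continuous_intros)

text \<open>Off the tube \<open>F\<close> is arbitrary, so only its cut-off can be expected to be
  Borel; \<open>tube_measurable\<close> then removes the cut-off for maps with values in the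
  tube.\<close>

lemma borel_measurable_tube_cut:
  assumes "holo_on F (tube :: (complex ^ 'n) set)"
  shows "(\<lambda>z. if z \<in> tube then F z else 0) \<in> borel_measurable borel"
  using holo_on_imp_continuous_on[OF assms]
  by (intro borel_measurable_continuous_on_if borel_open open_tube) auto

lemma tube_measurable:
  assumes F: "holo_on F (tube :: (complex ^ 'n) set)" and [measurable]: "f \<in> borel_measurable M"
    and "\<And>x. x \<in> space M \<Longrightarrow> f x \<in> tube"
  shows "(\<lambda>x. F (f x)) \<in> borel_measurable M"
proof -
  have "(\<lambda>x. if f x \<in> tube then F (f x) else 0) \<in> borel_measurable M"
    using measurable_compose[OF assms(2) borel_measurable_tube_cut[OF F]] by simp
  then show ?thesis by (rule measurable_cong[THEN iffD1, rotated]) (use assms(3) in auto)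
qed

section \<open>Changes of variables for Lebesgue measure\<close>

lemma nn_integral_lborel_affine:
  fixes f :: "'a::euclidean_space \<Rightarrow> ennreal"
  assumes [measurable]: "f \<in> borel_measurable borel" and c: "c \<noteq> 0"
  shows "(\<integral>\<^sup>+x. f x \<partial>lborel) = ennreal (\<bar>c\<bar> ^ DIM('a)) * (\<integral>\<^sup>+x. f (t + c *\<^sub>R x) \<partial>lborel)"
  by (subst lborel_affine[OF c, of t])
     (simp add: nn_integral_density nn_integral_distr nn_integral_cmult)

lemma nn_integral_lborel_translate:
  fixes f :: "'a::euclidean_space \<Rightarrow> ennreal"
  assumes [measurable]: "f \<in> borel_measurable borel"
  shows "(\<integral>\<^sup>+x. f (x + t) \<partial>lborel) = (\<integral>\<^sup>+x. f x \<partial>lborel)"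
  using nn_integral_lborel_affine[OF assms, of 1 t] by (simp add: add.commute)

text \<open>The map is multiplication of \<open>u + \<i> w\<close> by the unit number
  \<open>c + \<i> s\<close>. It is decomposed into substitutions in one variable at a time with
  Fubini in between, and the Jacobian factors \<open>k\<close> and \<open>k'\<close> cancel. The
  case \<open>c = 0\<close> is an exchange of the variables with a reflection.\<close>

lemma nn_integral_lborel_rotate:
  fixes g :: "'a::euclidean_space \<times> 'a \<Rightarrow> ennreal"
  assumes [measurable]: "g \<in> borel_measurable borel" and cs: "c\<^sup>2 + s\<^sup>2 = (1::real)"
  shows "(\<integral>\<^sup>+u. \<integral>\<^sup>+w. g (c *\<^sub>R u - s *\<^sub>R w, s *\<^sub>R u + c *\<^sub>R w) \<partial>lborel \<partial>lborel) = (\<integral>\<^sup>+u. \<integral>\<^sup>+w. g (u, w) \<partial>lborel \<partial>lborel)"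
proof -
  have [measurable]: "g \<in> borel_measurable (borel \<Otimes>\<^sub>M borel)" by (simp add: borel_prod)
  show ?thesis
  proof (cases "c = 0")
    case True
    then have s: "\<bar>s\<bar> = 1" using cs by (auto simp: power2_eq_1_iff)
    then have s0: "s \<noteq> 0" "- s \<noteq> 0" by auto
    have "(\<integral>\<^sup>+u. \<integral>\<^sup>+w. g (c *\<^sub>R u - s *\<^sub>R w, s *\<^sub>R u + c *\<^sub>R w) \<partial>lborel \<partial>lborel)
       = (\<integral>\<^sup>+u. \<integral>\<^sup>+w. g (w, s *\<^sub>R u) \<partial>lborel \<partial>lborel)"
    proof (rule nn_integral_cong)
      fix u :: 'a
      show "(\<integral>\<^sup>+w. g (c *\<^sub>R u - s *\<^sub>R w, s *\<^sub>R u + c *\<^sub>R w) \<partial>lborel) = (\<integral>\<^sup>+w. g (w, s *\<^sub>R u) \<partial>lborel)"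
        using nn_integral_lborel_affine[of "\<lambda>w. g (w, s *\<^sub>R u)" "- s" 0] s0 s True by simp
    qed
    also have "\<dots> = (\<integral>\<^sup>+w. \<integral>\<^sup>+u. g (w, s *\<^sub>R u) \<partial>lborel \<partial>lborel)"
      by (rule lborel_pair.Fubini'[symmetric]) measurable
    also have "\<dots> = (\<integral>\<^sup>+w. \<integral>\<^sup>+u. g (w, u) \<partial>lborel \<partial>lborel)"
    proof (rule nn_integral_cong)
      fix w :: 'a
      show "(\<integral>\<^sup>+u. g (w, s *\<^sub>R u) \<partial>lborel) = (\<integral>\<^sup>+u. g (w, u) \<partial>lborel)"
        using nn_integral_lborel_affine[of "\<lambda>u. g (w, u)" "s" 0] s0 s by simp
    qed
    finally show ?thesis .
  next
    case False
    define k where "k = ennreal (\<bar>c\<bar> ^ DIM('a))"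
    define k' where "k' = ennreal (\<bar>1/c\<bar> ^ DIM('a))"
    have kk: "k * k' = 1" using False by (simp add: k_def k'_def ennreal_mult[symmetric] power_mult_distrib[symmetric] abs_mult[symmetric])
    have k0: "k \<noteq> 0" "k \<noteq> \<infinity>" using False by (auto simp: k_def)
    have "k * (\<integral>\<^sup>+u. \<integral>\<^sup>+w. g (c *\<^sub>R u - s *\<^sub>R w, s *\<^sub>R u + c *\<^sub>R w) \<partial>lborel \<partial>lborel)
      = k * (\<integral>\<^sup>+w. \<integral>\<^sup>+u. g (c *\<^sub>R u - s *\<^sub>R w, s *\<^sub>R u + c *\<^sub>R w) \<partial>lborel \<partial>lborel)"
      by (rule arg_cong[where f="(*) k"], rule lborel_pair.Fubini'[symmetric]) measurable
    also have "\<dots> = (\<integral>\<^sup>+w. k * (\<integral>\<^sup>+u. g (c *\<^sub>R u - s *\<^sub>R w, s *\<^sub>R u + c *\<^sub>R w) \<partial>lborel) \<partial>lborel)"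
      by (rule nn_integral_cmult[symmetric]) measurable
    also have "\<dots> = (\<integral>\<^sup>+w. \<integral>\<^sup>+u. g (u, (s/c) *\<^sub>R u + (1/c) *\<^sub>R w) \<partial>lborel \<partial>lborel)"
    proof (rule nn_integral_cong)
      fix w :: 'a
      \<comment> \<open>The second rotated coordinate expressed through the first rotated coordinate
        and \<open>w\<close>; here \<open>c^2 + s^2 = 1\<close> enters.\<close>
      have eq: "(s/c) *\<^sub>R (- s *\<^sub>R w + c *\<^sub>R u) + (1/c) *\<^sub>R w = s *\<^sub>R u + c *\<^sub>R w" for u
      proof -
        have "(1 - s\<^sup>2) / c = c" using cs False by (simp add: field_simps power2_eq_square)
        then have "((s/c) * (-s) + 1/c) = c" by (simp add: power2_eq_square diff_divide_distrib)
        moreover have "(s/c) *\<^sub>R (- s *\<^sub>R w + c *\<^sub>R u) + (1/c) *\<^sub>R w = ((s/c) * (-s) + 1/c) *\<^sub>R w + s *\<^sub>R u"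
          using False by (simp add: algebra_simps)
        ultimately show ?thesis by (simp add: add.commute)
      qed
      show "k * (\<integral>\<^sup>+u. g (c *\<^sub>R u - s *\<^sub>R w, s *\<^sub>R u + c *\<^sub>R w) \<partial>lborel) = (\<integral>\<^sup>+u. g (u, (s/c) *\<^sub>R u + (1/c) *\<^sub>R w) \<partial>lborel)"
        by (subst nn_integral_lborel_affine[of "\<lambda>u. g (u, (s/c) *\<^sub>R u + (1/c) *\<^sub>R w)" c "- s *\<^sub>R w", OF _ False], measurable)
           (simp only: eq k_def, simp add: algebra_simps)
    qed
    also have "\<dots> = (\<integral>\<^sup>+u. \<integral>\<^sup>+w. g (u, (s/c) *\<^sub>R u + (1/c) *\<^sub>R w) \<partial>lborel \<partial>lborel)"
      by (rule lborel_pair.Fubini') measurable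
    also have "\<dots> = (\<integral>\<^sup>+u. k * (\<integral>\<^sup>+w. g (u, w) \<partial>lborel) \<partial>lborel)"
    proof (rule nn_integral_cong)
      fix u :: 'a
      have "(\<integral>\<^sup>+w. g (u, w) \<partial>lborel) = k' * (\<integral>\<^sup>+w. g (u, (s/c) *\<^sub>R u + (1/c) *\<^sub>R w) \<partial>lborel)"
        unfolding k'_def by (rule nn_integral_lborel_affine) (use False in auto)
      then show "(\<integral>\<^sup>+w. g (u, (s/c) *\<^sub>R u + (1/c) *\<^sub>R w) \<partial>lborel) = k * (\<integral>\<^sup>+w. g (u, w) \<partial>lborel)"
        by (simp add: mult.assoc[symmetric] kk)
    qed
    also have "\<dots> = k * (\<integral>\<^sup>+u. \<integral>\<^sup>+w. g (u, w) \<partial>lborel \<partial>lborel)"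
      by (rule nn_integral_cmult) measurable
    finally show ?thesis using k0 by (simp add: ennreal_mult_cancel_left)
  qed
qed

lemma nn_integral_circ_eq_cmean:
  assumes "continuous_on (sphere 0 1) u" "\<And>z. u z \<ge> 0"
  shows "(\<integral>\<^sup>+t. ennreal (u (circ t)) * indicator {0..1} t \<partial>lborel) = ennreal (cmean u)"
  unfolding cmean_def
  by (rule nn_integral_has_integral_lebesgue') (use assms integrable_circ[OF assms(1)] in auto)

lemma norm_powr_sub_mean:
  assumes "p > 0" "R > 1" "f holomorphic_on ball 0 R"
  shows "ennreal (norm (f 0) powr p) \<le> (\<integral>\<^sup>+t. ennreal (norm (f (circ t)) powr p) * indicator {0..1} t \<partial>lborel)"
proof -
  have "continuous_on (sphere 0 1) f"
    using assms by (auto intro!: continuous_on_subset[OF holomorphic_on_imp_continuous_on[OF assms(3)]])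
  then have "continuous_on (sphere 0 1) (\<lambda>z. norm (f z) powr p)"
    using assms by (intro continuous_on_norm_powr)
  moreover have "norm (f 0) powr p \<le> cmean (\<lambda>z. norm (f z) powr p)"
    using mean_oscillation[OF assms(1), of 1] assms by auto
  ultimately show ?thesis using nn_integral_circ_eq_cmean[of "\<lambda>z. norm (f z) powr p"] by (simp add: ennreal_leI)
qed

text \<open>\<open>mean_oscillation\<close> with its negative term moved to the left, since
  subtraction in \<open>ennreal\<close> is truncated. As \<open>C\<close> precedes \<open>f\<close>,
  the inequality can be integrated over families of functions.\<close>

lemma nn_mean_oscillation:
  assumes p: "p > 0" and eta: "\<eta> > 0"
  shows "\<exists>C\<ge>0. \<forall>f R. R > 1 \<longrightarrow> f holomorphic_on ball 0 R \<longrightarrow>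
     (\<integral>\<^sup>+t. ennreal (norm (f (circ t) - f 0) powr p) * indicator {0..1} t \<partial>lborel) + ennreal C * ennreal (norm (f 0) powr p)
       \<le> ennreal (\<eta> + C) * (\<integral>\<^sup>+t. ennreal (norm (f (circ t)) powr p) * indicator {0..1} t \<partial>lborel)"
proof -
  obtain C where C: "C \<ge> 0" and *: "\<And>f R. R > 1 \<Longrightarrow> f holomorphic_on ball 0 R \<Longrightarrow>
      cmean (\<lambda>z. norm (f z - f 0) powr p) \<le> \<eta> * cmean (\<lambda>z. norm (f z) powr p) + C * (cmean (\<lambda>z. norm (f z) powr p) - norm (f 0) powr p)
      \<and> norm (f 0) powr p \<le> cmean (\<lambda>z. norm (f z) powr p)"
    using mean_oscillation[OF p eta] by metis
  show ?thesis
  proof (intro exI[of _ C] conjI allI impI)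
    fix f and R :: real assume R: "R > 1" and f: "f holomorphic_on ball 0 R"
    have cf: "continuous_on (sphere 0 1) f"
      using R by (auto intro!: continuous_on_subset[OF holomorphic_on_imp_continuous_on[OF f]])
    have c1: "continuous_on (sphere 0 1) (\<lambda>z. norm (f z) powr p)" "continuous_on (sphere 0 1) (\<lambda>z. norm (f z - f 0) powr p)"
      using p by (intro continuous_on_norm_powr continuous_intros cf; simp)+
    have n: "cmean (\<lambda>z. norm (f z - f 0) powr p) \<ge> 0"
      using cmean_mono[of "\<lambda>_. 0", OF _ c1(2)] by simp
    show "(\<integral>\<^sup>+t. ennreal (norm (f (circ t) - f 0) powr p) * indicator {0..1} t \<partial>lborel) + ennreal C * ennreal (norm (f 0) powr p)
       \<le> ennreal (\<eta> + C) * (\<integral>\<^sup>+t. ennreal (norm (f (circ t)) powr p) * indicator {0..1} t \<partial>lborel)"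
    proof -
      have "cmean (\<lambda>z. norm (f z - f 0) powr p) + C * norm (f 0) powr p \<le> (\<eta> + C) * cmean (\<lambda>z. norm (f z) powr p)"
        using *[OF R f] by (simp add: algebra_simps)
      then show ?thesis
        unfolding nn_integral_circ_eq_cmean[OF c1(1) powr_ge_zero] nn_integral_circ_eq_cmean[OF c1(2) powr_ge_zero]
        using C n eta by (simp add: ennreal_mult'[symmetric] ennreal_plus[symmetric] ennreal_leI del: ennreal_plus)
    qed
  qed (rule C)
qed

section \<open>Hardy functions are bounded away from the boundary\<close>

lemma Hp_norm_le:
  assumes "p > 0" "K \<ge> 0" "\<And>y. y \<in> octant \<Longrightarrow> p_integral p F y \<le> ennreal K"
  shows "Hp_norm p F \<le> ennreal (K powr (1 / p))"
  unfolding Hp_norm_def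
proof (rule SUP_least)
  fix y :: "real ^ 'a" assume "y \<in> octant"
  then have le: "p_integral p F y \<le> ennreal K" by (rule assms(3))
  then have fin: "p_integral p F y \<noteq> \<infinity>" by (auto simp: top_unique)
  have "enn2real (p_integral p F y) \<le> K"
    using le assms(2) by (metis enn2real_ennreal enn2real_mono ennreal_less_top)
  then have "enn2real (p_integral p F y) powr (1/p) \<le> K powr (1/p)"
    using assms(1) by (intro powr_mono2) auto
  then show "(if p_integral p F y = \<infinity> then \<infinity> else ennreal (enn2real (p_integral p F y) powr (1 / p))) \<le> ennreal (K powr (1 / p))"
    using fin by (simp add: ennreal_leI)
qed

text \<open>Trades the norm, with its root and its case distinction, for a uniform bound on the
  slice integrals, which is the form used from here on.\<close>

lemma Hp_iff:
  assumes p: "p > 0"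
  shows "F \<in> Hp p \<longleftrightarrow> holo_on F tube \<and> (\<exists>K\<ge>0. \<forall>y\<in>octant. p_integral p F y \<le> ennreal K)"
proof -
  have "\<exists>K\<ge>0. \<forall>y\<in>octant. p_integral p F y \<le> ennreal K" if fin: "Hp_norm p F < \<infinity>"
  proof -
    obtain H where H: "H \<ge> 0" "Hp_norm p F = ennreal H" using fin by (cases "Hp_norm p F") auto
    have "p_integral p F y \<le> ennreal (H powr p)" if y: "y \<in> octant" for y
    proof -
      have le: "(if p_integral p F y = \<infinity> then \<infinity> else ennreal (enn2real (p_integral p F y) powr (1 / p))) \<le> ennreal H"
        unfolding H(2)[symmetric] Hp_norm_def by (rule SUP_upper[OF y])
      then have f: "p_integral p F y \<noteq> \<infinity>" by (auto simp: top_unique split: if_splits)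
      then have "enn2real (p_integral p F y) powr (1 / p) \<le> H" using le H(1) by simp
      then have "(enn2real (p_integral p F y) powr (1 / p)) powr p \<le> H powr p"
        using p by (intro powr_mono2) auto
      then have "enn2real (p_integral p F y) \<le> H powr p" using p by (simp add: powr_powr)
      then show ?thesis using f by (metis ennreal_enn2real_if ennreal_leI infinity_ennreal_def)
    qed
    then show ?thesis by (intro exI[of _ "H powr p"]) auto
  qed
  moreover have "Hp_norm p F < \<infinity>" if "K \<ge> 0" "\<forall>y\<in>octant. p_integral p F y \<le> ennreal K" for K
    using Hp_norm_le[OF p that(1), of F] that(2) by (metis ennreal_less_top infinity_ennreal_def order_le_less_trans)
  ultimately show ?thesis unfolding Hp_def by blast
qed

lemma line_in_tube:
  fixes z v :: "complex ^ 'n"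
  assumes "\<And>j. Im (z $ j) \<ge> 2 * a" "\<And>j. norm (v $ j) < a" "norm l < 2"
  shows "z + l *s v \<in> tube"
  unfolding tube_def
proof (intro CollectI allI)
  fix j
  have a: "a > 0" using assms(2)[of j] norm_ge_zero[of "v $ j"] by linarith
  have "norm (l * v $ j) < 2 * a"
    unfolding norm_mult by (rule mult_strict_mono) (use assms a in auto)
  then have "\<bar>Im (l * v $ j)\<bar> < 2 * a" using abs_Im_le_cmod[of "l * v $ j"] by linarith
  then show "Im ((z + l *s v) $ j) > 0" using assms(1)[of j] by simp
qed

text \<open>The sub-mean value inequality on the circles \<open>z + circ t *s v\<close>, averaged over all \<open>v\<close> in a polydisc; the
  polydisc is invariant under multiplication by \<open>circ t\<close>.\<close>

lemma Hp_bounded: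
  fixes F :: "complex ^ 'n \<Rightarrow> complex"
  assumes p: "p > 0" and F: "F \<in> Hp p" and a: "a > 0"
  shows "\<exists>B. \<forall>z :: complex ^ 'n. (\<forall>j. Im (z $ j) \<ge> 2 * a) \<longrightarrow> norm (F z) \<le> B"
proof -
  have hF: "holo_on F tube" using F Hp_iff[OF p] by blast
  obtain K where K: "K \<ge> 0" "\<And>y. y \<in> octant \<Longrightarrow> p_integral p F y \<le> ennreal K" using F Hp_iff[OF p] by blast
  define D where "D = {(u :: real ^ 'n, w :: real ^ 'n). \<forall>j. norm (cpt u w $ j) < a}"
  have oD: "open D"
  proof -
    have "D = (\<Inter>j. {uw. norm (cpt (fst uw) (snd uw) $ j) < a})" by (auto simp: D_def)
    moreover have "open (\<Inter>j. {uw :: (real ^ 'n) \<times> (real ^ 'n). norm (cpt (fst uw) (snd uw) $ j) < a})"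
      by (intro open_INT finite ballI open_Collect_less continuous_intros)
    ultimately show ?thesis by (simp only:)
  qed
  then have [measurable]: "D \<in> sets borel" by simp
  \<comment> \<open>The boxes satisfy
    \<open>Q \<times> Q \<subseteq> D \<subseteq> UNIV \<times> Q'\<close>: the small one bounds the
    measure of the polydisc from below, the large one confines the imaginary displacements, so that
    the real ones may be integrated over the whole space.\<close>
  define Q where "Q = (box (\<chi> j. - (a/2)) (\<chi> j. a/2) :: (real ^ 'n) set)"
  define Q' where "Q' = (box (\<chi> j. - a) (\<chi> j. a) :: (real ^ 'n) set)"
  have [measurable]: "Q \<in> sets borel" "Q' \<in> sets borel" by (auto simp: Q_def Q'_def)
  have Q: "u \<in> Q \<longleftrightarrow> (\<forall>j. \<bar>u $ j\<bar> < a/2)" for u :: "real ^ 'n"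
    unfolding Q_def mem_box_cart vec_lambda_beta abs_less_iff by (meson minus_less_iff)
  have Q': "u \<in> Q' \<longleftrightarrow> (\<forall>j. \<bar>u $ j\<bar> < a)" for u :: "real ^ 'n"
    unfolding Q'_def mem_box_cart vec_lambda_beta abs_less_iff by (meson minus_less_iff)
  define q where "q = measure lborel Q"
  have q: "emeasure lborel Q = ennreal q"
  proof -
    have "emeasure lborel Q < \<infinity>" unfolding Q_def by (rule emeasure_lborel_box_finite)
    then show ?thesis unfolding q_def by (intro emeasure_eq_ennreal_measure) auto
  qed
  have q0: "q > 0"
  proof -
    have "0 \<in> Q" using Q[of 0] a by simp
    moreover have "open Q" unfolding Q_def by (rule open_box)
    ultimately have "\<not> negligible Q" using open_not_negligible by blast
    then have "emeasure lborel Q \<noteq> 0"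
      using negligible_iff_emeasure0[of Q] by (auto simp: Q_def emeasure_completion)
    then show ?thesis unfolding q using measure_nonneg[of lborel Q] by (auto simp: q_def less_le)
  qed
  have Q'f: "emeasure lborel Q' \<noteq> \<infinity>" 
  proof -
    have "emeasure lborel Q' < \<infinity>" unfolding Q'_def by (rule emeasure_lborel_box_finite)
    then show ?thesis by simp
  qed
  have QD: "(u, w) \<in> D" if "u \<in> Q" "w \<in> Q" for u w
    unfolding D_def
  proof (clarsimp)
    fix j
    have "norm (Complex (u $ j) (w $ j)) \<le> \<bar>u $ j\<bar> + \<bar>w $ j\<bar>" using cmod_le[of "Complex (u $ j) (w $ j)"] by simp
    also have "\<dots> < a" using that Q by (metis add_strict_mono field_sum_of_halves)
    finally show "norm (Complex (u $ j) (w $ j)) < a" .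
  qed
  have DQ': "w \<in> Q'" if "(u, w) \<in> D" for u w
    using that unfolding D_def Q' by (auto intro: le_less_trans[OF abs_Im_le_cmod, of "Complex (u $ j) (w $ j)" for j, simplified])
  have main: "ennreal (norm (F z) powr p) * (ennreal q * ennreal q) \<le> emeasure lborel Q' * ennreal K"
    if z: "\<forall>j. Im (z $ j) \<ge> 2 * a" for z :: "complex ^ 'n"
  proof -
    define g where "g uw = (if uw \<in> D then ennreal (norm (F (z + cpt (fst uw) (snd uw))) powr p) else 0)" for uw
    have inT: "z + l *s cpt (fst uw) (snd uw) \<in> tube" if "uw \<in> D" "norm l < 2" for uw l
      by (rule line_in_tube[where a=a]) (use that z in \<open>auto simp: D_def\<close>)
    have mg: "g \<in> borel_measurable borel"
    proof -
      have "continuous_on D (\<lambda>uw. ennreal (norm (F (z + cpt (fst uw) (snd uw))) powr p))"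
        by (intro continuous_on_ennreal continuous_on_norm_powr p
             continuous_on_compose2[OF holo_on_imp_continuous_on[OF hF]] continuous_intros)
           (use inT[of _ 1] in auto)
      then show ?thesis unfolding g_def by (intro borel_measurable_continuous_on_if) auto
    qed
    then have mg' [measurable]: "g \<in> borel_measurable (borel \<Otimes>\<^sub>M borel)" by (simp add: borel_prod)
    define T where "T t u w = g (Re (circ t) *\<^sub>R u - Im (circ t) *\<^sub>R w, Im (circ t) *\<^sub>R u + Re (circ t) *\<^sub>R w)" for t u w
    have Tm [measurable (raw)]: "(\<lambda>x. T (t x) (u x) (w x)) \<in> borel_measurable M"
      if [measurable]: "t \<in> borel_measurable M" "u \<in> borel_measurable M" "w \<in> borel_measurable M"
      for M :: "'x measure" and t u w
      unfolding T_def by measurable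
    have pt: "ennreal (norm (F z) powr p) * indicator D (u, w) \<le> (\<integral>\<^sup>+t. T t u w * indicator {0..1} t \<partial>lborel)" for u w
    proof (cases "(u, w) \<in> D")
      case True
      define f where "f l = F (z + l *s cpt u w)" for l
      have "f holomorphic_on ball 0 2" unfolding f_def
        by (rule holo_on_line[OF hF]) (use inT[OF True] in auto)
      from norm_powr_sub_mean[OF p _ this]
      have "ennreal (norm (F z) powr p) \<le> (\<integral>\<^sup>+t. ennreal (norm (f (circ t)) powr p) * indicator {0..1} t \<partial>lborel)"
        by (simp add: f_def)
      also have "\<dots> = (\<integral>\<^sup>+t. T t u w * indicator {0..1} t \<partial>lborel)"
      proof (rule nn_integral_cong)
        fix t
        have "(Re (circ t) *\<^sub>R u - Im (circ t) *\<^sub>R w, Im (circ t) *\<^sub>R u + Re (circ t) *\<^sub>R w) \<in> D"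
          unfolding D_def
        proof (clarsimp simp only: smult_cpt[symmetric])
          fix j
          have "norm ((circ t *s cpt u w) $ j) = norm (cpt u w $ j)"
            by (simp only: vector_smult_component norm_mult norm_circ mult_1)
          then show "norm ((circ t *s cpt u w) $ j) < a" using True by (simp add: D_def)
        qed
        then show "ennreal (norm (f (circ t)) powr p) * indicator {0..1} t = T t u w * indicator {0..1} t"
          unfolding f_def T_def g_def smult_cpt by simp
      qed
      finally show ?thesis using True by simp
    qed auto
    have "ennreal (norm (F z) powr p) * (ennreal q * ennreal q)
       = (\<integral>\<^sup>+u. \<integral>\<^sup>+w. ennreal (norm (F z) powr p) * (indicator Q u * indicator Q w) \<partial>lborel \<partial>lborel)"
      by (simp add: nn_integral_cmult nn_integral_multc q[symmetric])
    also have "\<dots> \<le> (\<integral>\<^sup>+u. \<integral>\<^sup>+w. ennreal (norm (F z) powr p) * indicator D (u, w) \<partial>lborel \<partial>lborel)"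
      by (intro nn_integral_mono mult_left_mono) (auto simp: indicator_def QD)
    also have "\<dots> \<le> (\<integral>\<^sup>+u. \<integral>\<^sup>+w. \<integral>\<^sup>+t. T t u w * indicator {0..1} t \<partial>lborel \<partial>lborel \<partial>lborel)"
      by (intro nn_integral_mono pt)
    \<comment> \<open>Once \<open>t\<close> is outermost, invariance under the rotation by
      \<open>circ t\<close> makes the inner double integral independent of \<open>t\<close>.\<close>
    also have "\<dots> = (\<integral>\<^sup>+u. \<integral>\<^sup>+t. \<integral>\<^sup>+w. T t u w * indicator {0..1} t \<partial>lborel \<partial>lborel \<partial>lborel)"
      by (intro nn_integral_cong lborel_pair.Fubini'[symmetric]) measurable
    also have "\<dots> = (\<integral>\<^sup>+t. \<integral>\<^sup>+u. \<integral>\<^sup>+w. T t u w * indicator {0..1} t \<partial>lborel \<partial>lborel \<partial>lborel)"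
      by (rule lborel_pair.Fubini'[symmetric]) measurable
    also have "\<dots> = (\<integral>\<^sup>+t. (\<integral>\<^sup>+u. \<integral>\<^sup>+w. g (u, w) \<partial>lborel \<partial>lborel) * indicator {0..1::real} t \<partial>lborel)"
    proof (rule nn_integral_cong)
      fix t
      have "(\<integral>\<^sup>+u. \<integral>\<^sup>+w. T t u w * indicator {0..1} t \<partial>lborel \<partial>lborel) = (\<integral>\<^sup>+u. \<integral>\<^sup>+w. T t u w \<partial>lborel \<partial>lborel) * indicator {0..1} t"
        by (simp add: nn_integral_multc)
      also have "(\<integral>\<^sup>+u. \<integral>\<^sup>+w. T t u w \<partial>lborel \<partial>lborel) = (\<integral>\<^sup>+u. \<integral>\<^sup>+w. g (u, w) \<partial>lborel \<partial>lborel)"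
        unfolding T_def using norm_circ[of t]
        by (intro nn_integral_lborel_rotate mg) (simp add: cmod_def)
      finally show "(\<integral>\<^sup>+u. \<integral>\<^sup>+w. T t u w * indicator {0..1} t \<partial>lborel \<partial>lborel) = (\<integral>\<^sup>+u. \<integral>\<^sup>+w. g (u, w) \<partial>lborel \<partial>lborel) * indicator {0..1} t" .
    qed
    also have "\<dots> = (\<integral>\<^sup>+u. \<integral>\<^sup>+w. g (u, w) \<partial>lborel \<partial>lborel)"
      by (simp add: nn_integral_cmult)
    also have "\<dots> = (\<integral>\<^sup>+w. \<integral>\<^sup>+u. g (u, w) \<partial>lborel \<partial>lborel)"
      by (rule lborel_pair.Fubini'[symmetric]) measurable
    also have "\<dots> \<le> (\<integral>\<^sup>+w. ennreal K * indicator Q' w \<partial>lborel)"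
    proof (rule nn_integral_mono)
      fix w :: "real ^ 'n"
      show "(\<integral>\<^sup>+u. g (u, w) \<partial>lborel) \<le> ennreal K * indicator Q' w"
      proof (cases "w \<in> Q'")
        case False
        then have "g (u, w) = 0" for u using DQ' by (auto simp: g_def)
        then show ?thesis by simp
      next
        case True
        define x y where "x = (\<chi> j. Re (z $ j))" and "y = (\<chi> j. Im (z $ j))"
        have zxy: "z = cpt x y" unfolding x_def y_def by (rule cpt_Re_Im)
        have yw: "y + w \<in> octant"
        proof -
          have "(y + w) $ j > 0" for j
            using True z[rule_format, of j] a unfolding Q' y_def
            by (simp add: abs_less_iff) (smt (verit))
          then show ?thesis by (simp add: octant_def)
        qed
        have [measurable]: "(\<lambda>u. F (cpt u (y + w))) \<in> borel_measurable borel"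
          by (rule tube_measurable[OF hF]) (use yw in auto)
        have "(\<integral>\<^sup>+u. g (u, w) \<partial>lborel) \<le> (\<integral>\<^sup>+u. ennreal (norm (F (cpt (u + x) (y + w))) powr p) \<partial>lborel)"
          by (rule nn_integral_mono) (auto simp: g_def zxy cpt_add add.commute)
        also have "\<dots> = (\<integral>\<^sup>+u. ennreal (norm (F (cpt u (y + w))) powr p) \<partial>lborel)"
          by (rule nn_integral_lborel_translate) measurable
        also have "\<dots> \<le> ennreal K" using K(2)[OF yw] by (simp add: p_integral_def)
        finally show ?thesis using True by simp
      qed
    qed
    also have "\<dots> = emeasure lborel Q' * ennreal K" by (simp add: nn_integral_cmult mult.commute)
    finally show ?thesis .
  qed
  define m where "m = measure lborel Q'"
  have m: "emeasure lborel Q' = ennreal m" unfolding m_def using Q'f by (intro emeasure_eq_ennreal_measure) auto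
  define B where "B = (m * K / (q * q)) powr (1/p)"
  have "norm (F z) \<le> B" if z: "\<forall>j. Im (z $ j) \<ge> 2 * a" for z :: "complex ^ 'n"
  proof -
    have "ennreal (norm (F z) powr p * (q * q)) \<le> ennreal (m * K)"
      using main[OF z] q0 K(1) by (simp add: m ennreal_mult[symmetric] m_def)
    then have "norm (F z) powr p * (q * q) \<le> m * K" using K(1) by (subst (asm) ennreal_le_iff) (auto simp: m_def)
    then have "norm (F z) powr p \<le> m * K / (q * q)" using q0 by (simp add: field_simps)
    then have "(norm (F z) powr p) powr (1/p) \<le> B" unfolding B_def using p by (intro powr_mono2) auto
    then show ?thesis using p by (simp add: powr_powr)
  qed
  then show ?thesis by blast
qed

section \<open>Poisson inequalities on complex half-planes\<close>

text \<open>The Cayley map of the disc onto the upper half-plane; at its pole \<open>1\<close> it takes the value \<open>0\<close>.\<close>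

definition mobius :: "complex \<Rightarrow> complex" where
  "mobius w = \<i> * (1 + w) / (1 - w)"

text \<open>For \<open>0 < t < 1\<close> this is \<open>- cot (pi * t)\<close>. For \<open>t\<close>
  uniform on the unit interval its distribution is the Cauchy distribution, that is, the Poisson
  kernel of the upper half-plane at \<open>\<i>\<close>.\<close>

definition mline :: "real \<Rightarrow> real" where
  "mline t = Re (mobius (circ t))"

lemma mobius_0 [simp]: "mobius 0 = \<i>"
  by (simp add: mobius_def)

lemma Im_mobius: "Im (mobius w) = (1 - (norm w)\<^sup>2) / (norm (1 - w))\<^sup>2"
  unfolding mobius_def cmod_power2 Im_divide by (simp add: power2_eq_square algebra_simps)

lemma Im_mobius_pos: "norm w < 1 \<Longrightarrow> Im (mobius w) > 0"
  unfolding Im_mobius by (intro divide_pos_pos) (auto simp: abs_square_less_1)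

lemma mobius_circ: "mobius (circ t) = of_real (mline t)"
  by (simp add: complex_eq_iff mline_def Im_mobius)

lemma holomorphic_mobius: "mobius holomorphic_on ball 0 1"
  unfolding mobius_def by (intro holomorphic_intros) auto

lemma borel_measurable_mobius [measurable]: "mobius \<in> borel_measurable borel"
  unfolding mobius_def by measurable

lemma borel_measurable_mline [measurable]: "mline \<in> borel_measurable borel"
  unfolding mline_def by measurable

lemma circ_neq_1:
  assumes "0 < t" "t < 1"
  shows "circ t \<noteq> 1"
proof
  assume "circ t = 1"
  then have "cos (2 * pi * t) = 1" by (simp add: circ_def complex_eq_iff)
  then obtain n :: int where "2 * pi * t = n * 2 * pi" using cos_one_2pi_int by auto
  then have "t = n" by simp
  with assms show False by auto
qed

text \<open>The unit circle meets the pole of \<open>mobius\<close>, so circle inequalities are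
  first applied on smaller concentric circles. The \<open>+ 2\<close> keeps the radius positive at
  \<open>n = 0\<close>.\<close>

definition inner_radius :: "nat \<Rightarrow> real" where
  "inner_radius n = 1 - 1 / (real n + 2)"

lemma inner_radius: "0 < inner_radius n" "inner_radius n < 1"
  by (auto simp: inner_radius_def field_simps)

lemma mobius_inner_radius_tendsto:
  assumes "0 < t" "t < 1"
  shows "(\<lambda>n. mobius (inner_radius n * circ t)) \<longlonglongrightarrow> of_real (mline t)"
proof -
  have "inner_radius \<longlonglongrightarrow> 1" unfolding inner_radius_def by real_asymp
  then have "(\<lambda>n. complex_of_real (inner_radius n)) \<longlonglongrightarrow> complex_of_real 1"
    by (simp only: tendsto_of_real_iff)
  then have "(\<lambda>n. complex_of_real (inner_radius n) * circ t) \<longlonglongrightarrow> of_real 1 * circ t"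
    by (rule tendsto_mult[OF _ tendsto_const])
  moreover have "isCont mobius (circ t)"
    unfolding mobius_def using circ_neq_1[OF assms] by (intro continuous_intros) auto
  ultimately show ?thesis unfolding mobius_circ[symmetric] using isCont_tendsto_compose[of "circ t" mobius] by simp
qed

section \<open>Analytic half-planes inside the tube\<close>

lemma octant_add_scaleR:
  assumes "y \<in> octant" "\<And>j. v $ j \<ge> 0" "s \<ge> 0"
  shows "y + s *\<^sub>R v \<in> octant"
  using assms by (auto simp: octant_def add_pos_nonneg)

lemma octant_add:
  assumes "y \<in> octant" "\<And>j. v $ j \<ge> 0"
  shows "y + v \<in> octant"
  using octant_add_scaleR[OF assms, of 1] by simp

lemma cpt_add_smult_real: "cpt x y + l *s cpt v 0 = cpt (x + Re l *\<^sub>R v) (y + Im l *\<^sub>R v)"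
  by (simp add: smult_cpt cpt_add)

lemma tube_line:
  assumes "y \<in> octant" "\<And>j. v $ j \<ge> 0" "Im l \<ge> 0"
  shows "cpt x y + l *s cpt v 0 \<in> tube"
  unfolding cpt_add_smult_real by (simp add: octant_add_scaleR assms)

lemma Im_mobius_inner_radius: "Im (mobius (inner_radius n * circ t)) > 0"
  using inner_radius[of n] by (intro Im_mobius_pos) (simp add: norm_mult)

text \<open>The radius \<open>1 / inner_radius n\<close> exceeds 1, as the circle inequalities
  require; after scaling, \<open>mobius\<close> sends this disc into the open upper half-plane,
  where the line stays in the tube.\<close>

lemma holomorphic_mobius_line:
  assumes F: "holo_on F tube" and y: "y \<in> octant" "\<And>j. v $ j \<ge> 0"
  shows "(\<lambda>w. F (cpt x y + mobius (inner_radius n * w) *s cpt v 0)) holomorphic_on ball 0 (1 / inner_radius n)"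
proof -
  have m: "inner_radius n * w \<in> ball 0 1" if "w \<in> ball 0 (1 / inner_radius n)" for w :: complex
    using that inner_radius[of n] by (simp add: norm_mult field_simps)
  have 1: "(\<lambda>l. F (cpt x y + l *s cpt v 0)) holomorphic_on {l. Im l > 0}"
    by (rule holo_on_line[OF F]) (auto intro!: tube_line y)
  have 2: "(\<lambda>w. mobius (inner_radius n * w)) holomorphic_on ball 0 (1 / inner_radius n)"
    by (rule holomorphic_on_compose_gen[OF _ holomorphic_mobius, unfolded o_def])
       (use m in \<open>auto intro!: holomorphic_intros\<close>)
  have "(\<lambda>w :: complex. mobius (inner_radius n * w)) ` ball 0 (1 / inner_radius n) \<subseteq> {l. 0 < Im l}"
    using m by (auto intro!: Im_mobius_pos)
  from holomorphic_on_compose_gen[OF 2 1 this] show ?thesis by (simp add: o_def)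
qed

lemma tube_line_tendsto:
  assumes F: "holo_on F tube" and y: "y \<in> octant" and t: "0 < t" "t < 1"
  shows "(\<lambda>n. F (cpt x y + mobius (inner_radius n * circ t) *s cpt v 0)) \<longlonglongrightarrow> F (cpt (x + mline t *\<^sub>R v) y)"
proof -
  have "isCont (\<lambda>l. cpt x y + l *s cpt v 0) (of_real (mline t))"
  proof -
    have "continuous_on UNIV (\<lambda>l. cpt x y + l *s cpt v 0)" by (intro continuous_intros)
    then show ?thesis using continuous_on_eq_continuous_at[OF open_UNIV] by blast
  qed
  from isCont_tendsto_compose[OF this mobius_inner_radius_tendsto[OF t]]
  have "(\<lambda>n. cpt x y + mobius (inner_radius n * circ t) *s cpt v 0) \<longlonglongrightarrow> cpt (x + mline t *\<^sub>R v) y"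
    by (simp add: cpt_add_smult_real)
  moreover have "isCont F (cpt (x + mline t *\<^sub>R v) y)"
    using holo_on_imp_continuous_on[OF F] open_tube y continuous_on_eq_continuous_at by fastforce
  ultimately show ?thesis using isCont_tendsto_compose by blast
qed

lemma tendsto_norm_powr_ennreal:
  fixes f :: "nat \<Rightarrow> 'a::real_normed_vector"
  assumes "p > 0" "f \<longlonglongrightarrow> l"
  shows "(\<lambda>n. ennreal (norm (f n) powr p)) \<longlonglongrightarrow> ennreal (norm l powr p)"
  using assms by (intro tendsto_ennrealI tendsto_powr' tendsto_intros) auto

lemma AE_open_unit_interval: "AE t in lborel. t \<in> {0..1} \<longrightarrow> 0 < t \<and> t < (1::real)"
proof -
  have "AE t in lborel. t \<notin> {0, 1::real}" by (rule AE_not_in) (simp add: finite_imp_null_set_lborel)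
  then show ?thesis by (rule eventually_mono) auto
qed

text \<open>The half-plane Poisson inequality at \<open>\<i>\<close>, with the harmonic measure of the real line parametrised by \<open>mline\<close>.\<close>

lemma Hp_line_sub_mean:
  assumes p: "p > 0" and F: "F \<in> Hp p" and y: "y \<in> octant" and v: "\<And>j. v $ j \<ge> 0"
  shows "ennreal (norm (F (cpt x (y + v))) powr p)
    \<le> (\<integral>\<^sup>+t. ennreal (norm (F (cpt (x + mline t *\<^sub>R v) y)) powr p) * indicator {0..1} t \<partial>lborel)"
proof -
  have hF: "holo_on F tube" using F Hp_iff[OF p] by blast
  \<comment> \<open>All points \<open>y + s * v\<close> with \<open>s \<ge> 0\<close> have
    coordinates at least \<open>2 * a\<close>, so \<open>F\<close> is bounded on the whole
    half-plane and a constant on the unit interval serves as majorant.\<close>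
  define a where "a = Min (range (\<lambda>j. y $ j)) / 2"
  have ay: "y $ j \<ge> 2 * a" for j by (simp add: a_def)
  have a0: "a > 0" using y unfolding a_def octant_def by (subst half_gt_zero_iff, subst Min_gr_iff) auto
  obtain B where B: "\<And>z. (\<forall>j. Im (z $ j) \<ge> 2 * a) \<Longrightarrow> norm (F z) \<le> B"
    using Hp_bounded[OF p F a0] by blast
  define G where "G n t = F (cpt x y + mobius (inner_radius n * circ t) *s cpt v 0)" for n t
  have Gm [measurable]: "G n \<in> borel_measurable borel" for n
    unfolding G_def by (rule tube_measurable[OF hF]) (auto intro!: tube_line y v less_imp_le[OF Im_mobius_inner_radius])
  have Hm [measurable]: "(\<lambda>t. F (cpt (x + mline t *\<^sub>R v) y)) \<in> borel_measurable borel"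
    by (rule tube_measurable[OF hF]) (use y in auto)
  have Gb: "norm (G n t) \<le> B" for n t
    unfolding G_def cpt_add_smult_real
  proof (rule B, rule allI)
    fix j
    show "2 * a \<le> Im (cpt (x + Re (mobius (inner_radius n * circ t)) *\<^sub>R v) (y + Im (mobius (inner_radius n * circ t)) *\<^sub>R v) $ j)"
      using ay[of j] v[of j] Im_mobius_inner_radius[of n t] by (simp add: add_increasing2)
  qed
  have "(\<lambda>n. \<integral>\<^sup>+t. ennreal (norm (G n t) powr p) * indicator {0..1} t \<partial>lborel)
    \<longlonglongrightarrow> (\<integral>\<^sup>+t. ennreal (norm (F (cpt (x + mline t *\<^sub>R v) y)) powr p) * indicator {0..1} t \<partial>lborel)"
  proof (rule nn_integral_dominated_convergence[where w="\<lambda>t. ennreal (B powr p) * indicator {0..1} t"])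
    show "AE t in lborel. ennreal (norm (G n t) powr p) * indicator {0..1} t \<le> ennreal (B powr p) * indicator {0..1} t" for n
      using Gb p by (intro AE_I2 mult_right_mono ennreal_leI powr_mono2) auto
    show "(\<integral>\<^sup>+t. ennreal (B powr p) * indicator {0..1} t \<partial>(lborel :: real measure)) < \<infinity>"
      by (simp add: nn_integral_cmult)
    show "AE t in lborel. (\<lambda>n. ennreal (norm (G n t) powr p) * indicator {0..1} t)
       \<longlonglongrightarrow> ennreal (norm (F (cpt (x + mline t *\<^sub>R v) y)) powr p) * indicator {0..1} t"
      using AE_open_unit_interval
    proof (rule eventually_mono)
      fix t :: real assume t: "t \<in> {0..1} \<longrightarrow> 0 < t \<and> t < 1"
      show "(\<lambda>n. ennreal (norm (G n t) powr p) * indicator {0..1} t)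
         \<longlonglongrightarrow> ennreal (norm (F (cpt (x + mline t *\<^sub>R v) y)) powr p) * indicator {0..1} t"
      proof (cases "t \<in> {0..1}")
        case True
        then show ?thesis using tendsto_norm_powr_ennreal[OF p tube_line_tendsto[OF hF y, of t]] t by (simp add: G_def)
      qed auto
    qed
  qed auto
  moreover have "ennreal (norm (F (cpt x (y + v))) powr p) \<le> (\<integral>\<^sup>+t. ennreal (norm (G n t) powr p) * indicator {0..1} t \<partial>lborel)" for n
    using norm_powr_sub_mean[OF p _ holomorphic_mobius_line[OF hF y v, of x n]] inner_radius[of n]
    by (simp add: G_def cpt_add_smult_real)
  ultimately show ?thesis by (intro LIMSEQ_le_const) auto
qed

text \<open>Integrate the half-plane inequality over \<open>x\<close> and exchange the integrals:
  for each \<open>t\<close> the inner integral is that of a horizontal translate, hence the slice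
  integral at \<open>y\<close>, and the measure in \<open>t\<close> has mass 1.\<close>

lemma p_integral_antimono:
  assumes p: "p > 0" and F: "F \<in> Hp p" and y: "y \<in> octant" and v: "\<And>j. v $ j \<ge> 0"
  shows "p_integral p F (y + v) \<le> p_integral p F y"
proof -
  have hF: "holo_on F tube" using F Hp_iff[OF p] by blast
  have [measurable]: "(\<lambda>x. F (cpt x y)) \<in> borel_measurable borel"
    by (rule tube_measurable[OF hF]) (use y in auto)
  have "p_integral p F (y + v) \<le> (\<integral>\<^sup>+x. \<integral>\<^sup>+t. ennreal (norm (F (cpt (x + mline t *\<^sub>R v) y)) powr p) * indicator {0..1} t \<partial>lborel \<partial>lborel)"
    unfolding p_integral_def by (intro nn_integral_mono Hp_line_sub_mean[OF p F y v])
  also have "\<dots> = (\<integral>\<^sup>+t. \<integral>\<^sup>+x. ennreal (norm (F (cpt (x + mline t *\<^sub>R v) y)) powr p) * indicator {0..1} t \<partial>lborel \<partial>lborel)"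
    by (rule lborel_pair.Fubini'[symmetric]) measurable
  also have "\<dots> = (\<integral>\<^sup>+t. p_integral p F y * indicator {0..1::real} t \<partial>lborel)"
  proof (rule nn_integral_cong)
    fix t
    have "(\<integral>\<^sup>+x. ennreal (norm (F (cpt (x + mline t *\<^sub>R v) y)) powr p) * indicator {0..1} t \<partial>lborel)
      = (\<integral>\<^sup>+x. ennreal (norm (F (cpt (x + mline t *\<^sub>R v) y)) powr p) \<partial>lborel) * indicator {0..1} t"
      by (rule nn_integral_multc) measurable
    also have "(\<integral>\<^sup>+x. ennreal (norm (F (cpt (x + mline t *\<^sub>R v) y)) powr p) \<partial>lborel) = p_integral p F y"
      using nn_integral_lborel_translate[of "\<lambda>x. ennreal (norm (F (cpt x y)) powr p)" "mline t *\<^sub>R v"]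
      by (simp add: p_integral_def)
    finally show "(\<integral>\<^sup>+x. ennreal (norm (F (cpt (x + mline t *\<^sub>R v) y)) powr p) * indicator {0..1} t \<partial>lborel) = p_integral p F y * indicator {0..1} t" .
  qed
  also have "\<dots> = p_integral p F y" by (simp add: nn_integral_cmult)
  finally show ?thesis .
qed

text \<open>\<open>nn_mean_oscillation\<close> on the half-plane attached to each \<open>x\<close>,
  integrated over \<open>x\<close>. The inner circles meet various heights above \<open>y\<close>,
  all covered by \<open>K\<close>. That \<open>C\<close> is fixed before \<open>y\<close> and
  \<open>v\<close> is essential, because these are later chosen according to
  \<open>C\<close>.\<close>

lemma Hp_line_oscillation:
  assumes p: "p > 0" and eta: "\<eta> > 0"
  shows "\<exists>C\<ge>0. \<forall>(F :: complex ^ 'n \<Rightarrow> complex) y v K. holo_on F tube \<longrightarrow> K \<ge> 0 \<longrightarrow> (\<forall>y\<in>octant. p_integral p F y \<le> ennreal K)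
      \<longrightarrow> y \<in> octant \<longrightarrow> (\<forall>j. v $ j \<ge> 0) \<longrightarrow>
     (\<integral>\<^sup>+t. (\<integral>\<^sup>+x. ennreal (norm (F (cpt (x + mline t *\<^sub>R v) y) - F (cpt x (y + v))) powr p) \<partial>lborel) * indicator {0..1} t \<partial>lborel)
       + ennreal C * p_integral p F (y + v) \<le> ennreal ((\<eta> + C) * K)"
proof -
  obtain C where C: "C \<ge> 0" and osc: "\<forall>f R. R > 1 \<longrightarrow> f holomorphic_on ball 0 R \<longrightarrow>
     (\<integral>\<^sup>+t. ennreal (norm (f (circ t) - f 0) powr p) * indicator {0..1} t \<partial>lborel) + ennreal C * ennreal (norm (f 0) powr p)
       \<le> ennreal (\<eta> + C) * (\<integral>\<^sup>+t. ennreal (norm (f (circ t)) powr p) * indicator {0..1} t \<partial>lborel)"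
    using nn_mean_oscillation[OF p eta] by blast
  show ?thesis
  proof (intro exI[of _ C] conjI allI impI, rule C)
    fix F :: "complex ^ 'n \<Rightarrow> complex" and y v :: "real ^ 'n" and K :: real
    assume hF: "holo_on F tube" and K0: "K \<ge> 0" and K: "\<forall>y\<in>octant. p_integral p F y \<le> ennreal K"
      and y: "y \<in> octant" and v': "\<forall>j. v $ j \<ge> 0"
    then have v: "\<And>j. v $ j \<ge> 0" by blast
    have yv: "y + v \<in> octant" by (rule octant_add[OF y v])
    define G where "G n t x = F (cpt x y + mobius (inner_radius n * circ t) *s cpt v 0)" for n t x
    have Gm [measurable (raw)]: "(\<lambda>w. G n (f w) (g w)) \<in> borel_measurable M"
      if [measurable]: "f \<in> borel_measurable M" "g \<in> borel_measurable M" for n f g and M :: "'x measure"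
      unfolding G_def by (rule tube_measurable[OF hF]) (auto intro!: tube_line y v less_imp_le[OF Im_mobius_inner_radius])
    define H where "H t x = F (cpt (x + mline t *\<^sub>R v) y)" for t x
    have Hm [measurable (raw)]: "(\<lambda>w. H (f w) (g w)) \<in> borel_measurable M"
      if [measurable]: "f \<in> borel_measurable M" "g \<in> borel_measurable M" for f g and M :: "'x measure"
      unfolding H_def by (rule tube_measurable[OF hF]) (use y in auto)
    define E where "E x = F (cpt x (y + v))" for x
    have Em [measurable]: "E \<in> borel_measurable borel"
      unfolding E_def by (rule tube_measurable[OF hF]) (use yv in auto)
    define D where "D n t x = (ennreal (norm (G n t x - E x) powr p) + ennreal C * ennreal (norm (E x) powr p)) * indicator {0..1} t" for n t x
    define D' where "D' t x = (ennreal (norm (H t x - E x) powr p) + ennreal C * ennreal (norm (E x) powr p)) * indicator {0..1} t" for t x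
    have Dm [measurable (raw)]: "(\<lambda>w. D n (f w) (g w)) \<in> borel_measurable M"
      if [measurable]: "f \<in> borel_measurable M" "g \<in> borel_measurable M" for n f g and M :: "'x measure"
      unfolding D_def by measurable
    have D'm [measurable (raw)]: "(\<lambda>w. D' (f w) (g w)) \<in> borel_measurable M"
      if [measurable]: "f \<in> borel_measurable M" "g \<in> borel_measurable M" for f g and M :: "'x measure"
      unfolding D'_def by measurable
    have bound: "(\<integral>\<^sup>+x. \<integral>\<^sup>+t. D n t x \<partial>lborel \<partial>lborel) \<le> ennreal ((\<eta> + C) * K)" for n
    proof -
      have "(\<integral>\<^sup>+x. \<integral>\<^sup>+t. D n t x \<partial>lborel \<partial>lborel)
         \<le> (\<integral>\<^sup>+x. ennreal (\<eta> + C) * (\<integral>\<^sup>+t. ennreal (norm (G n t x) powr p) * indicator {0..1} t \<partial>lborel) \<partial>lborel)"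
      proof (rule nn_integral_mono)
        fix x
        have "(\<integral>\<^sup>+t. D n t x \<partial>lborel) = (\<integral>\<^sup>+t. ennreal (norm (G n t x - E x) powr p) * indicator {0..1} t \<partial>lborel)
            + (\<integral>\<^sup>+t. (ennreal C * ennreal (norm (E x) powr p)) * indicator {0..1::real} t \<partial>lborel)"
          unfolding D_def distrib_right by (rule nn_integral_add) measurable
        also have "(\<integral>\<^sup>+t. (ennreal C * ennreal (norm (E x) powr p)) * indicator {0..1::real} t \<partial>lborel) = ennreal C * ennreal (norm (E x) powr p)"
          by (simp add: nn_integral_cmult)
        finally show "(\<integral>\<^sup>+t. D n t x \<partial>lborel) \<le> ennreal (\<eta> + C) * (\<integral>\<^sup>+t. ennreal (norm (G n t x) powr p) * indicator {0..1} t \<partial>lborel)"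
          using osc[rule_format, OF _ holomorphic_mobius_line[OF hF y v, of x n]] inner_radius[of n]
          by (simp add: G_def E_def cpt_add_smult_real)
      qed
      also have "\<dots> = ennreal (\<eta> + C) * (\<integral>\<^sup>+x. \<integral>\<^sup>+t. ennreal (norm (G n t x) powr p) * indicator {0..1} t \<partial>lborel \<partial>lborel)"
        by (rule nn_integral_cmult) measurable
      also have "(\<integral>\<^sup>+x. \<integral>\<^sup>+t. ennreal (norm (G n t x) powr p) * indicator {0..1} t \<partial>lborel \<partial>lborel)
        = (\<integral>\<^sup>+t. \<integral>\<^sup>+x. ennreal (norm (G n t x) powr p) * indicator {0..1} t \<partial>lborel \<partial>lborel)"
        by (rule lborel_pair.Fubini'[symmetric]) measurable
      \<comment> \<open>For fixed \<open>t\<close> the point of the inner circle sits at the single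
        height \<open>y + Im l * v\<close> for all \<open>x\<close>, and \<open>Re l\<close>
        contributes only a translation.\<close>
      also have "\<dots> \<le> (\<integral>\<^sup>+t. ennreal K * indicator {0..1::real} t \<partial>lborel)"
      proof (rule nn_integral_mono)
        fix t
        define l where "l = mobius (inner_radius n * circ t)"
        have l: "Im l \<ge> 0" using Im_mobius_inner_radius[of n t] by (simp add: l_def)
        have yl: "y + Im l *\<^sub>R v \<in> octant" by (rule octant_add_scaleR[OF y v l])
        have [measurable]: "(\<lambda>x. F (cpt x (y + Im l *\<^sub>R v))) \<in> borel_measurable borel"
          by (rule tube_measurable[OF hF]) (use yl in auto)
        have "(\<integral>\<^sup>+x. ennreal (norm (G n t x) powr p) * indicator {0..1} t \<partial>lborel) = (\<integral>\<^sup>+x. ennreal (norm (G n t x) powr p) \<partial>lborel) * indicator {0..1} t"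
          by (rule nn_integral_multc) measurable
        also have "(\<integral>\<^sup>+x. ennreal (norm (G n t x) powr p) \<partial>lborel) = (\<integral>\<^sup>+x. ennreal (norm (F (cpt (x + Re l *\<^sub>R v) (y + Im l *\<^sub>R v))) powr p) \<partial>lborel)"
          unfolding G_def cpt_add_smult_real l_def ..
        also have "\<dots> = p_integral p F (y + Im l *\<^sub>R v)"
          using nn_integral_lborel_translate[of "\<lambda>x. ennreal (norm (F (cpt x (y + Im l *\<^sub>R v))) powr p)" "Re l *\<^sub>R v"]
          by (simp add: p_integral_def)
        also have "\<dots> \<le> ennreal K" using K yl by blast
        finally show "(\<integral>\<^sup>+x. ennreal (norm (G n t x) powr p) * indicator {0..1} t \<partial>lborel) \<le> ennreal K * indicator {0..1} t"
          by (simp add: mult_right_mono)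
      qed
      also have "\<dots> = ennreal K" by (simp add: nn_integral_cmult)
      finally show ?thesis using K0 C eta by (simp add: ennreal_mult mult_left_mono)
    qed
    \<comment> \<open>The radius tends to 1 by Fatou's lemma, first in \<open>t\<close> and then in
      \<open>x\<close>; an upper bound for the limit is all that is wanted.\<close>
    have "(\<integral>\<^sup>+x. \<integral>\<^sup>+t. D' t x \<partial>lborel \<partial>lborel) \<le> (\<integral>\<^sup>+x. liminf (\<lambda>n. \<integral>\<^sup>+t. D n t x \<partial>lborel) \<partial>lborel)"
    proof (rule nn_integral_mono)
      fix x
      have "(\<integral>\<^sup>+t. D' t x \<partial>lborel) = (\<integral>\<^sup>+t. liminf (\<lambda>n. D n t x) \<partial>lborel)"
      proof (rule nn_integral_cong_AE, use AE_open_unit_interval in \<open>rule eventually_mono\<close>)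
        fix t :: real assume t: "t \<in> {0..1} \<longrightarrow> 0 < t \<and> t < 1"
        have "(\<lambda>n. D n t x) \<longlonglongrightarrow> D' t x"
        proof (cases "t \<in> {0..1}")
          case True
          then have "(\<lambda>n. G n t x - E x) \<longlonglongrightarrow> H t x - E x"
            unfolding G_def H_def using t by (intro tendsto_diff tendsto_const tube_line_tendsto[OF hF y]) auto
          from tendsto_add[OF tendsto_norm_powr_ennreal[OF p this] tendsto_const] True show ?thesis
            by (simp add: D_def D'_def)
        qed (simp add: D_def D'_def)
        then show "D' t x = liminf (\<lambda>n. D n t x)" by (simp add: lim_imp_Liminf)
      qed
      also have "\<dots> \<le> liminf (\<lambda>n. \<integral>\<^sup>+t. D n t x \<partial>lborel)"
        by (rule nn_integral_liminf) measurable
      finally show "(\<integral>\<^sup>+t. D' t x \<partial>lborel) \<le> liminf (\<lambda>n. \<integral>\<^sup>+t. D n t x \<partial>lborel)" .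
    qed
    also have "\<dots> \<le> liminf (\<lambda>n. \<integral>\<^sup>+x. \<integral>\<^sup>+t. D n t x \<partial>lborel \<partial>lborel)"
      by (rule nn_integral_liminf) measurable
    also have "\<dots> \<le> ennreal ((\<eta> + C) * K)"
      by (rule order_trans[OF Liminf_le_Limsup Limsup_bounded]) (auto intro!: bound always_eventually)
    finally have le: "(\<integral>\<^sup>+x. \<integral>\<^sup>+t. D' t x \<partial>lborel \<partial>lborel) \<le> ennreal ((\<eta> + C) * K)" .
    have "(\<integral>\<^sup>+x. \<integral>\<^sup>+t. D' t x \<partial>lborel \<partial>lborel) = (\<integral>\<^sup>+t. \<integral>\<^sup>+x. D' t x \<partial>lborel \<partial>lborel)"
      by (rule lborel_pair.Fubini'[symmetric]) measurable
    also have "\<dots> = (\<integral>\<^sup>+t. (\<integral>\<^sup>+x. ennreal (norm (H t x - E x) powr p) \<partial>lborel) * indicator {0..1} t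
         + (ennreal C * p_integral p F (y + v)) * indicator {0..1::real} t \<partial>lborel)"
    proof (rule nn_integral_cong)
      fix t
      show "(\<integral>\<^sup>+x. D' t x \<partial>lborel) = (\<integral>\<^sup>+x. ennreal (norm (H t x - E x) powr p) \<partial>lborel) * indicator {0..1} t
         + (ennreal C * p_integral p F (y + v)) * indicator {0..1} t"
        unfolding D'_def p_integral_def E_def[symmetric]
        by (simp add: nn_integral_multc nn_integral_add nn_integral_cmult distrib_right)
    qed
    also have "\<dots> = (\<integral>\<^sup>+t. (\<integral>\<^sup>+x. ennreal (norm (H t x - E x) powr p) \<partial>lborel) * indicator {0..1} t \<partial>lborel)
         + (\<integral>\<^sup>+t. (ennreal C * p_integral p F (y + v)) * indicator {0..1::real} t \<partial>lborel)"
      by (rule nn_integral_add) measurable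
    also have "(\<integral>\<^sup>+t. (ennreal C * p_integral p F (y + v)) * indicator {0..1::real} t \<partial>lborel) = ennreal C * p_integral p F (y + v)"
      by (simp add: nn_integral_cmult)
    finally show "(\<integral>\<^sup>+t. (\<integral>\<^sup>+x. ennreal (norm (F (cpt (x + mline t *\<^sub>R v) y) - F (cpt x (y + v))) powr p) \<partial>lborel) * indicator {0..1} t \<partial>lborel)
       + ennreal C * p_integral p F (y + v) \<le> ennreal ((\<eta> + C) * K)"
      using le unfolding H_def E_def by simp
  qed
qed

section \<open>Approximation by translates\<close>

lemma p_integral_translate:
  assumes F: "holo_on F tube" and y: "y + d \<in> octant"
  shows "p_integral p (\<lambda>z. F (z + cpt s d)) y = p_integral p F (y + d)"
proof -
  have [measurable]: "(\<lambda>x. F (cpt x (y + d))) \<in> borel_measurable borel"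
    by (rule tube_measurable[OF F]) (use y in auto)
  show ?thesis
    using nn_integral_lborel_translate[of "\<lambda>x. ennreal (norm (F (cpt x (y + d))) powr p)" s]
    by (simp add: p_integral_def cpt_add)
qed

lemma p_integral_add_le:
  assumes p: "p > 0" and F: "holo_on F tube" and G: "holo_on G tube" and y: "y \<in> octant"
  shows "p_integral p (\<lambda>z. F z + G z) y \<le> ennreal (2 powr p) * (p_integral p F y + p_integral p G y)"
proof -
  have [measurable]: "(\<lambda>x. F (cpt x y)) \<in> borel_measurable borel" "(\<lambda>x. G (cpt x y)) \<in> borel_measurable borel"
    by (auto intro!: tube_measurable[OF F] tube_measurable[OF G] simp: y)
  have "p_integral p (\<lambda>z. F z + G z) y
    \<le> (\<integral>\<^sup>+x. ennreal (2 powr p) * (ennreal (norm (F (cpt x y)) powr p) + ennreal (norm (G (cpt x y)) powr p)) \<partial>lborel)"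
    unfolding p_integral_def
    by (intro nn_integral_mono) (simp add: ennreal_mult[symmetric] ennreal_plus[symmetric] norm_add_powr_le[OF p] ennreal_leI del: ennreal_plus)
  also have "\<dots> = ennreal (2 powr p) * (p_integral p F y + p_integral p G y)"
    unfolding p_integral_def by (simp add: nn_integral_cmult nn_integral_add)
  finally show ?thesis .
qed

lemma Hp_mult_bounded:
  assumes p: "p > 0" and F: "F \<in> Hp p" and W: "holo_on W tube" and B: "\<And>z. z \<in> tube \<Longrightarrow> norm (W z) \<le> B"
  shows "(\<lambda>z. F z * W z) \<in> Hp p"
proof -
  obtain K where hF: "holo_on F tube" and K: "K \<ge> 0" "\<And>y. y \<in> octant \<Longrightarrow> p_integral p F y \<le> ennreal K"
    using F Hp_iff[OF p] by blast
  have "p_integral p (\<lambda>z. F z * W z) y \<le> ennreal (B powr p * K)" if y: "y \<in> octant" for y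
  proof -
    have [measurable]: "(\<lambda>x. F (cpt x y)) \<in> borel_measurable borel"
      by (rule tube_measurable[OF hF]) (use y in auto)
    have "p_integral p (\<lambda>z. F z * W z) y \<le> (\<integral>\<^sup>+x. ennreal (B powr p) * ennreal (norm (F (cpt x y)) powr p) \<partial>lborel)"
      unfolding p_integral_def
    proof (rule nn_integral_mono)
      fix x
      have "norm (W (cpt x y)) powr p \<le> B powr p" using B[of "cpt x y"] y p by (intro powr_mono2) auto
      then have "norm (F (cpt x y) * W (cpt x y)) powr p \<le> norm (F (cpt x y)) powr p * B powr p"
        by (simp add: norm_mult powr_mult mult_left_mono)
      then show "ennreal (norm (F (cpt x y) * W (cpt x y)) powr p) \<le> ennreal (B powr p) * ennreal (norm (F (cpt x y)) powr p)"
        by (simp add: ennreal_mult[symmetric] ennreal_leI mult.commute)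
    qed
    also have "\<dots> = ennreal (B powr p) * p_integral p F y"
      unfolding p_integral_def by (rule nn_integral_cmult) measurable
    also have "\<dots> \<le> ennreal (B powr p) * ennreal K" by (intro mult_left_mono K y) auto
    finally show ?thesis using K(1) by (simp add: ennreal_mult)
  qed
  then show ?thesis unfolding Hp_iff[OF p] using holo_on_mult[OF hF W] K(1)
    by (intro conjI exI[of _ "B powr p * K"]) auto
qed

lemma holo_on_translate_tube:
  assumes "holo_on F tube" "\<And>j. d $ j \<ge> 0"
  shows "holo_on (\<lambda>z. F (z + cpt s d)) tube"
  by (rule holo_on_translate[OF assms(1)]) (use assms(2) in \<open>auto simp: tube_def add_pos_nonneg\<close>)

lemma Hp_translate:
  assumes p: "p > 0" and F: "F \<in> Hp p" and d: "\<And>j. d $ j \<ge> 0"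
  shows "(\<lambda>z. F (z + cpt s d)) \<in> Hp p"
proof -
  obtain K where hF: "holo_on F tube" and K: "K \<ge> 0" "\<And>y. y \<in> octant \<Longrightarrow> p_integral p F y \<le> ennreal K"
    using F Hp_iff[OF p] by blast
  show ?thesis unfolding Hp_iff[OF p]
    using holo_on_translate_tube[OF hF d] K octant_add[OF _ d] p_integral_translate[OF hF, of _ d p s]
    by (intro conjI exI[of _ K]) auto
qed

lemma Hp_add:
  assumes p: "p > 0" and F: "F \<in> Hp p" and G: "G \<in> Hp p"
  shows "(\<lambda>z. F z + G z) \<in> Hp p"
proof -
  obtain K where hF: "holo_on F tube" and K: "K \<ge> 0" "\<And>y. y \<in> octant \<Longrightarrow> p_integral p F y \<le> ennreal K"
    using F Hp_iff[OF p] by blast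
  obtain L where hG: "holo_on G tube" and L: "L \<ge> 0" "\<And>y. y \<in> octant \<Longrightarrow> p_integral p G y \<le> ennreal L"
    using G Hp_iff[OF p] by blast
  have "p_integral p (\<lambda>z. F z + G z) y \<le> ennreal (2 powr p * (K + L))" if y: "y \<in> octant" for y
  proof -
    have "p_integral p (\<lambda>z. F z + G z) y \<le> ennreal (2 powr p) * (ennreal K + ennreal L)"
      by (rule order_trans[OF p_integral_add_le[OF p hF hG y]]) (intro mult_left_mono add_mono K L y, simp)
    then show ?thesis using K L by (simp add: ennreal_mult[symmetric] ennreal_plus[symmetric] del: ennreal_plus)
  qed
  then show ?thesis unfolding Hp_iff[OF p] using holo_on_add[OF hF hG] K(1) L(1)
    by (intro conjI exI[of _ "2 powr p * (K + L)"]) auto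
qed

lemma Hp_diff:
  assumes p: "p > 0" and F: "F \<in> Hp p" and G: "G \<in> Hp p"
  shows "(\<lambda>z. F z - G z) \<in> Hp p"
  using Hp_add[OF p F Hp_mult_bounded[OF p G holo_on_const[of "-1"], of 1]] by simp

text \<open>The oscillation estimate is applied with \<open>v = \<delta> * e\<close> at the diagonal
  heights \<open>s * e\<close>. Its error consists of \<open>\<eta> * K\<close>, small by the choice
  of \<open>\<eta>\<close>, and of \<open>C\<close> times the loss of the slice integral from its
  supremum, small by the choice of \<open>\<delta>\<close>. The diagonal is enough because every
  height in the octant dominates some small \<open>s * e\<close>.\<close>

lemma Hp_shift_approximation:
  fixes F :: "complex ^ 'n \<Rightarrow> complex"
  assumes p: "p > 0" and F: "F \<in> Hp p" and kap: "\<kappa> > 0"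
  shows "\<exists>s d. d \<in> octant \<and> (\<forall>y\<in>octant. p_integral p (\<lambda>z. F z - F (z + cpt s d)) y \<le> ennreal \<kappa>)"
proof -
  obtain K0 where hF: "holo_on F tube" and K0: "K0 \<ge> 0" "\<And>y. y \<in> octant \<Longrightarrow> p_integral p F y \<le> ennreal K0"
    using F Hp_iff[OF p] by blast
  define e :: "real ^ 'n" where "e = (\<chi> j. 1)"
  have e: "e $ j = 1" for j by (simp add: e_def)
  have oct_e: "s *\<^sub>R e \<in> octant" if "s > 0" for s using that by (simp add: octant_def e)
  \<comment> \<open>The bound \<open>K\<close> is taken to be the supremum itself: the estimate
    becomes small only if slice integrals come arbitrarily close to \<open>K\<close>.\<close>
  define S where "S = (SUP y\<in>octant. p_integral p F y)"
  have "S \<le> ennreal K0" unfolding S_def using K0 by (intro SUP_least) auto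
  then obtain K where K: "K \<ge> 0" "S = ennreal K" by (cases S) (auto simp: top_unique)
  have KS: "p_integral p F y \<le> ennreal K" if "y \<in> octant" for y
    using that K(2) unfolding S_def by (metis SUP_upper)
  \<comment> \<open>Gives \<open>\<eta> * K \<le> \<kappa> / 4\<close>, and \<open>\<kappa>'\<close>
    below gives \<open>C * \<kappa>' \<le> \<kappa> / 4\<close>; the remaining half of
    \<open>\<kappa>\<close> is the margin for selecting \<open>t\<close>. The \<open>+ 1\<close>
    covers \<open>K = 0\<close>.\<close>
  define \<eta> where "\<eta> = \<kappa> / (4 * (K + 1))"
  have eta: "\<eta> > 0" using kap K by (simp add: \<eta>_def)
  obtain C where C: "C \<ge> 0" and osc: "\<forall>(F :: complex ^ 'n \<Rightarrow> complex) y v K. holo_on F tube \<longrightarrow> K \<ge> 0 \<longrightarrow> (\<forall>y\<in>octant. p_integral p F y \<le> ennreal K)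
      \<longrightarrow> y \<in> octant \<longrightarrow> (\<forall>j. v $ j \<ge> 0) \<longrightarrow>
     (\<integral>\<^sup>+t. (\<integral>\<^sup>+x. ennreal (norm (F (cpt (x + mline t *\<^sub>R v) y) - F (cpt x (y + v))) powr p) \<partial>lborel) * indicator {0..1} t \<partial>lborel)
       + ennreal C * p_integral p F (y + v) \<le> ennreal ((\<eta> + C) * K)"
    using Hp_line_oscillation[OF p eta] by blast
  define \<kappa>' where "\<kappa>' = \<kappa> / (4 * (C + 1))"
  have kap': "\<kappa>' > 0" using kap C by (simp add: \<kappa>'_def)
  have "\<exists>y\<in>octant. S < p_integral p F y + ennreal \<kappa>'"
    by (rule SUP_approx_ennreal) (use kap' K oct_e[of 1] in \<open>auto simp: S_def\<close>)
  then obtain y0 where y0: "y0 \<in> octant" "ennreal K < p_integral p F y0 + ennreal \<kappa>'" using K by auto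
  \<comment> \<open>For \<open>s \<le> \<delta>\<close> the height \<open>(s + \<delta>) * e\<close>
    lies below \<open>y0\<close> in every coordinate, so the slice integral there is at least as
    close to the supremum as at \<open>y0\<close>.\<close>
  define \<delta> where "\<delta> = Min (range (\<lambda>j. y0 $ j)) / 2"
  have d0: "\<delta> > 0" using y0(1) unfolding \<delta>_def octant_def by (subst half_gt_zero_iff, subst Min_gr_iff) auto
  have dy: "2 * \<delta> \<le> y0 $ j" for j by (simp add: \<delta>_def)
  define \<Phi> where "\<Phi> s t = (\<integral>\<^sup>+x. ennreal (norm (F (cpt (x + mline t *\<^sub>R (\<delta> *\<^sub>R e)) (s *\<^sub>R e)) - F (cpt x (s *\<^sub>R e + \<delta> *\<^sub>R e))) powr p) \<partial>lborel)" for s t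
  have Phi: "(\<integral>\<^sup>+t. \<Phi> s t * indicator {0..1} t \<partial>lborel) \<le> ennreal (\<kappa> / 2)" if s: "0 < s" "s \<le> \<delta>" for s
  proof -
    define A where "A = (\<integral>\<^sup>+t. \<Phi> s t * indicator {0..1} t \<partial>lborel)"
    define J where "J = p_integral p F (s *\<^sub>R e + \<delta> *\<^sub>R e)"
    have ose: "s *\<^sub>R e + \<delta> *\<^sub>R e \<in> octant" using oct_e[of "s + \<delta>"] s d0 by (simp add: scaleR_add_left)
    have 1: "A + ennreal C * J \<le> ennreal ((\<eta> + C) * K)"
      unfolding A_def J_def \<Phi>_def
      by (rule osc[rule_format, OF hF K(1) KS oct_e[OF s(1)]]) (use d0 in \<open>auto simp: e\<close>)
    have "p_integral p F y0 \<le> J"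
      using p_integral_antimono[OF p F ose, of "y0 - (s *\<^sub>R e + \<delta> *\<^sub>R e)"] s dy e unfolding J_def
      by (simp add: e) (smt (verit, best) dy)
    then have 2: "ennreal K \<le> J + ennreal \<kappa>'" using y0(2) by (meson add_right_mono less_le_trans less_imp_le)
    \<comment> \<open>Finiteness of \<open>J\<close> comes first, because the term
      \<open>ennreal C * J\<close> is about to be cancelled.\<close>
    obtain j where j: "j \<ge> 0" "J = ennreal j" using KS[OF ose] unfolding J_def[symmetric]
      by (cases J) (auto simp: top_unique)
    have "A \<noteq> \<infinity>" using 1 by (auto simp: top_unique)
    then obtain a where a: "a \<ge> 0" "A = ennreal a" by (cases A) auto
    have "a + C * j \<le> (\<eta> + C) * K"
      using 1 C eta K(1) j a by (simp add: ennreal_mult[symmetric] ennreal_plus[symmetric] del: ennreal_plus)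
    moreover have "C * K \<le> C * (j + \<kappa>')"
      using 2 kap' j C by (intro mult_left_mono) (simp_all add: ennreal_plus[symmetric] del: ennreal_plus)
    ultimately have "a \<le> \<eta> * K + C * \<kappa>'" by (simp add: algebra_simps)
    also have "\<eta> * K \<le> \<kappa> / 4" using kap K(1) by (simp add: \<eta>_def field_simps)
    also have "C * \<kappa>' \<le> \<kappa> / 4" using kap C by (simp add: \<kappa>'_def field_simps)
    finally show ?thesis unfolding A_def[symmetric] a(2) by (intro ennreal_leI) simp
  qed
  define s where "s k = \<delta> / (real k + 1)" for k :: nat
  have s: "0 < s k" "s k \<le> \<delta>" for k using d0 by (auto simp: s_def field_simps)
  have Phim [measurable]: "\<Phi> (s k) \<in> borel_measurable borel" for k
  proof -
    have m1: "(\<lambda>w. F (cpt (snd w + mline (fst w) *\<^sub>R (\<delta> *\<^sub>R e)) (s k *\<^sub>R e))) \<in> borel_measurable (borel \<Otimes>\<^sub>M borel)"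
      by (rule tube_measurable[OF hF]) (use oct_e[OF s(1)] in auto)
    have m2: "(\<lambda>w. F (cpt (snd w) (s k *\<^sub>R e + \<delta> *\<^sub>R e))) \<in> borel_measurable (borel \<Otimes>\<^sub>M borel :: (real \<times> (real ^ 'n)) measure)"
    proof (rule tube_measurable[OF hF])
      show "cpt (snd w) (s k *\<^sub>R e + \<delta> *\<^sub>R e) \<in> tube" for w :: "real \<times> (real ^ 'n)"
        using oct_e[of "s k + \<delta>"] s(1)[of k] d0 by (simp add: scaleR_add_left)
    qed measurable
    have "(\<lambda>t. \<integral>\<^sup>+x. ennreal (norm (F (cpt (snd (t, x) + mline (fst (t, x)) *\<^sub>R (\<delta> *\<^sub>R e)) (s k *\<^sub>R e)) - F (cpt (snd (t, x)) (s k *\<^sub>R e + \<delta> *\<^sub>R e))) powr p) \<partial>lborel)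
        \<in> borel_measurable borel"
      by (rule lborel.borel_measurable_nn_integral) (use m1 m2 in \<open>simp add: split_beta'\<close>)
    then show ?thesis unfolding \<Phi>_def by simp
  qed
  \<comment> \<open>The mean over \<open>t\<close> is at most \<open>\<kappa> / 2\<close> for each
    \<open>k\<close>, so by Fatou the lower limit cannot reach \<open>\<kappa>\<close> for all
    \<open>t\<close>. The selected \<open>t\<close> depends on no single height.\<close>
  have "\<exists>t\<in>{0..1}. liminf (\<lambda>k. \<Phi> (s k) t) < ennreal \<kappa>"
  proof (rule ccontr)
    assume "\<not> ?thesis"
    then have ge: "ennreal \<kappa> \<le> liminf (\<lambda>k. \<Phi> (s k) t)" if "t \<in> {0..1}" for t using that by (meson not_less)
    have "ennreal \<kappa> = (\<integral>\<^sup>+t. ennreal \<kappa> * indicator {0..1::real} t \<partial>lborel)" by (simp add: nn_integral_cmult)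
    also have "\<dots> \<le> (\<integral>\<^sup>+t. liminf (\<lambda>k. \<Phi> (s k) t * indicator {0..1} t) \<partial>lborel)"
      by (rule nn_integral_mono) (use ge in \<open>auto simp: indicator_def\<close>)
    also have "\<dots> \<le> liminf (\<lambda>k. \<integral>\<^sup>+t. \<Phi> (s k) t * indicator {0..1} t \<partial>lborel)"
      by (rule nn_integral_liminf) measurable
    also have "\<dots> \<le> ennreal (\<kappa> / 2)"
      by (rule order_trans[OF Liminf_le_Limsup Limsup_bounded]) (auto intro!: always_eventually Phi s)
    finally show False using kap by simp
  qed
  then obtain t where t: "liminf (\<lambda>k. \<Phi> (s k) t) < ennreal \<kappa>" by blast
  define a where "a = mline t *\<^sub>R (\<delta> *\<^sub>R e)"
  define d where "d = \<delta> *\<^sub>R e"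
  have dd: "d \<in> octant" "d $ j \<ge> 0" for j using oct_e[OF d0] d0 by (auto simp: d_def e)
  \<comment> \<open>A difference of two translates of \<open>F\<close>, hence in \<open>H^p\<close>
    with decreasing slice integrals; those at the heights \<open>s k * e\<close>, which tend to 0,
    bound all others.\<close>
  define H where "H z = F (z + cpt a 0) - F (z + cpt 0 d)" for z
  have HH: "H \<in> Hp p" unfolding H_def
    by (intro Hp_diff Hp_translate p F dd) auto
  have HPhi: "p_integral p H (s k *\<^sub>R e) = \<Phi> (s k) t" for k
    unfolding p_integral_def \<Phi>_def H_def a_def d_def by (simp add: cpt_add)
  have Hle: "p_integral p H y \<le> ennreal \<kappa>" if y: "y \<in> octant" for y
  proof -
    define m where "m = Min (range (\<lambda>j. y $ j))"
    have m0: "m > 0" using y unfolding m_def octant_def by (subst Min_gr_iff) auto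
    have my: "m \<le> y $ j" for j by (simp add: m_def)
    have "s \<longlonglongrightarrow> 0" unfolding s_def by real_asymp
    then have "\<forall>\<^sub>F k in sequentially. s k < m" using m0 by (rule order_tendstoD)
    then have "\<forall>\<^sub>F k in sequentially. p_integral p H y \<le> \<Phi> (s k) t"
    proof (rule eventually_mono)
      fix k assume k: "s k < m"
      have "0 \<le> (y - s k *\<^sub>R e) $ j" for j using my[of j] k by (simp add: e)
      from p_integral_antimono[OF p HH oct_e[OF s(1)[of k]] this]
      show "p_integral p H y \<le> \<Phi> (s k) t" by (simp add: HPhi)
    qed
    then have "p_integral p H y \<le> liminf (\<lambda>k. \<Phi> (s k) t)" by (rule Liminf_bounded)
    then show ?thesis using t by simp
  qed
  have "p_integral p (\<lambda>z. F z - F (z + cpt (- a) d)) y \<le> ennreal \<kappa>" if y: "y \<in> octant" for y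
  proof -
    have h: "holo_on (\<lambda>z. F z - F (z + cpt (- a) d)) tube"
      by (intro holo_on_diff hF holo_on_translate_tube dd)
    \<comment> \<open>Translation by the real vector \<open>a\<close> turns the wanted difference
      into \<open>H\<close> and preserves slice integrals; \<open>y + 0\<close> matches the form of
      the translation rule.\<close>
    have "p_integral p (\<lambda>z. F z - F (z + cpt (- a) d)) (y + 0) = p_integral p (\<lambda>z. F (z + cpt a 0) - F (z + cpt a 0 + cpt (- a) d)) y"
      by (rule p_integral_translate[OF h, symmetric]) (use y in simp)
    also have "(\<lambda>z. F (z + cpt a 0) - F (z + cpt a 0 + cpt (- a) d)) = H"
      by (simp add: H_def fun_eq_iff add.assoc cpt_add)
    finally show ?thesis using Hle[OF y] by simp
  qed
  then show ?thesis using dd by blast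
qed

section \<open>Damping at infinity\<close>

text \<open>The base of each factor is \<open>1 / (1 - \<i> * r * w)\<close> at the coordinate
  \<open>w\<close> of \<open>z\<close>. For \<open>r > 0\<close> its pole \<open>- \<i> / r\<close>
  lies below the closed half-plane, on which the modulus is at most 1, and it tends to 1 as
  \<open>r\<close> tends to 0.\<close>

definition damping :: "nat \<Rightarrow> real \<Rightarrow> complex ^ 'n \<Rightarrow> complex" where
  "damping m r z = (\<Prod>j\<in>UNIV. (\<i> / (of_real r * z $ j + \<i>)) ^ m)"

lemma norm_add_i_ge:
  assumes "Im w \<ge> 0" "r \<ge> 0"
  shows "norm (of_real r * w + \<i>) \<ge> 1" "norm (of_real r * w + \<i>) \<ge> r * norm w"
proof -
  have im: "Im (of_real r * w + \<i>) \<ge> 1" using assms by simp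
  then show "norm (of_real r * w + \<i>) \<ge> 1" using abs_Im_le_cmod[of "of_real r * w + \<i>"] by linarith
  have "(r * norm w)\<^sup>2 \<le> (norm (of_real r * w + \<i>))\<^sup>2"
    unfolding power_mult_distrib cmod_power2 using assms by (simp add: power2_eq_square algebra_simps)
  then show "norm (of_real r * w + \<i>) \<ge> r * norm w" by (rule power2_le_imp_le) simp
qed

lemma norm_damping: "norm (damping m r z) = 1 / (\<Prod>j\<in>UNIV. norm (of_real r * z $ j + \<i>)) ^ m"
  unfolding damping_def by (simp add: prod_norm[symmetric] norm_power norm_divide power_divide prod_power_distrib prod_dividef)

lemma norm_damping_le_1:
  assumes "z \<in> tube" "r \<ge> 0"
  shows "norm (damping m r z) \<le> 1"
proof -
  have "1 \<le> (\<Prod>j\<in>UNIV. norm (of_real r * z $ j + \<i>))"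
    using assms by (intro prod_ge_1) (auto intro!: norm_add_i_ge simp: tube_def less_imp_le)
  then have "1 \<le> (\<Prod>j\<in>UNIV. norm (of_real r * z $ j + \<i>)) ^ m" by (rule one_le_power)
  then show ?thesis unfolding norm_damping by simp
qed

lemma holo_on_damping:
  assumes "r \<ge> 0"
  shows "holo_on (damping m r :: complex ^ 'n \<Rightarrow> complex) tube"
  unfolding damping_def
proof (intro holo_on_prod holo_on_power)
  fix j :: 'n
  show "holo_on (\<lambda>z. \<i> / (of_real r * z $ j + \<i>)) tube"
  proof (rule holo_on_compose_field[OF holo_on_component, of "\<lambda>w. \<i> / (of_real r * w + \<i>)" "{w. Im w > 0}"])
    have "of_real r * w + \<i> \<noteq> 0" if "Im w > 0" for w
    proof -
      have "norm (of_real r * w + \<i>) \<ge> 1" using that assms by (intro norm_add_i_ge) auto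
      then show ?thesis by auto
    qed
    then show "(\<lambda>w. \<i> / (of_real r * w + \<i>)) holomorphic_on {w. Im w > 0}"
      by (intro holomorphic_intros) auto
    show "open {w. Im w > 0}" by (rule open_halfspace_Im_gt)
  qed (simp add: tube_def)
qed

lemma damping_tendsto_1: "(\<lambda>k. damping m (1 / (real k + 1)) z) \<longlonglongrightarrow> 1"
proof -
  have "(\<lambda>k. 1 / (real k + 1)) \<longlonglongrightarrow> 0" by real_asymp
  then have r: "(\<lambda>k. complex_of_real (1 / (real k + 1))) \<longlonglongrightarrow> of_real 0" by (simp only: tendsto_of_real_iff)
  have "(\<lambda>k. damping m (1 / (real k + 1)) z) \<longlonglongrightarrow> (\<Prod>j\<in>UNIV. (\<i> / (of_real 0 * z $ j + \<i>)) ^ m)"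
    unfolding damping_def
    by (intro tendsto_prod tendsto_power tendsto_divide tendsto_add tendsto_mult tendsto_const r) auto
  then show ?thesis by simp
qed

text \<open>All \<open>q z j\<close> are at least 1, so their product \<open>Q\<close> dominates
  each of them and thereby, up to a constant, \<open>norm z\<close>. Of the \<open>Suc N\<close>
  powers of \<open>1 / Q\<close>, \<open>N\<close> absorb \<open>norm z ^ N\<close>, and the last
  one forces the limit 0.\<close>

lemma damping_decay:
  fixes c :: "complex ^ 'n"
  assumes c: "\<And>j. Im (c $ j) \<ge> 0" and r: "r > 0" and B: "\<And>z. z \<in> tube_closure \<Longrightarrow> norm (f z) \<le> B"
  shows "((\<lambda>z. norm z ^ N * norm (f z * damping (Suc N) r (z + c))) \<longlongrightarrow> 0) at_infty_tube"
proof -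
  define q where "q z j = norm (of_real r * (z + c) $ j + \<i>)" for z :: "complex ^ 'n" and j
  define Q where "Q z = (\<Prod>j\<in>UNIV. q z j)" for z
  define l where "l j = 1 / r + norm (c $ j)" for j
  define L where "L = (\<Sum>j\<in>UNIV. l j)"
  have l0: "l j > 0" for j using r by (simp add: l_def add_pos_nonneg)
  have L0: "L \<ge> 0" unfolding L_def using l0 by (intro sum_nonneg) (auto simp: less_imp_le)
  have zc: "Im ((z + c) $ j) \<ge> 0" if "z \<in> tube_closure" for z j
    using that c[of j] by (simp add: tube_closure_def)
  have q1: "q z j \<ge> 1" if "z \<in> tube_closure" for z j
    unfolding q_def using zc[OF that] r by (intro norm_add_i_ge) auto
  have qQ: "q z j \<le> Q z" if "z \<in> tube_closure" for z j
  proof -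
    have "Q z = q z j * (\<Prod>i\<in>UNIV - {j}. q z i)" unfolding Q_def by (rule prod.remove) auto
    moreover have "(\<Prod>i\<in>UNIV - {j}. q z i) \<ge> 1" using q1[OF that] by (intro prod_ge_1) auto
    ultimately show ?thesis using q1[OF that, of j] by (simp add: mult_le_cancel_left1)
  qed
  have zq: "norm (z $ j) \<le> l j * Q z" if z: "z \<in> tube_closure" for z j
  proof -
    have "norm (z $ j) \<le> norm ((z + c) $ j) + norm (c $ j)"
      using norm_triangle_ineq4[of "(z + c) $ j" "c $ j"] by simp
    also have "norm ((z + c) $ j) \<le> q z j / r"
      using norm_add_i_ge(2)[OF zc[OF z, of j], of r] r by (simp add: q_def field_simps)
    also have "norm (c $ j) \<le> norm (c $ j) * q z j" using q1[OF z, of j] by (simp add: mult_le_cancel_left1)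
    also have "q z j / r + norm (c $ j) * q z j = l j * q z j" by (simp add: l_def algebra_simps)
    also have "\<dots> \<le> l j * Q z" using qQ[OF z] l0 by (intro mult_left_mono) (auto simp: less_imp_le)
    finally show ?thesis by simp
  qed
  have Q1: "Q z \<ge> 1" if "z \<in> tube_closure" for z
    unfolding Q_def using q1[OF that] by (intro prod_ge_1) auto
  have zQ: "norm z \<le> L * Q z" if z: "z \<in> tube_closure" for z
  proof -
    have "norm z \<le> (\<Sum>j\<in>UNIV. norm (z $ j))" by (simp add: norm_vec_def L2_set_le_sum)
    also have "\<dots> \<le> (\<Sum>j\<in>UNIV. l j * Q z)" by (intro sum_mono zq z)
    finally show ?thesis by (simp add: L_def sum_distrib_right)
  qed
  \<comment> \<open>An arbitrary index, fixed to measure the decay of the last factor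
    \<open>1 / Q\<close>.\<close>
  define j0 :: 'n where "j0 = undefined"
  have B0: "B \<ge> 0"
    using B[of 0] norm_ge_zero[of "f 0"] by (simp add: tube_closure_def del: norm_ge_zero)
  have bound: "norm z ^ N * norm (f z * damping (Suc N) r (z + c)) \<le> L ^ N * B * l j0 / norm (z $ j0)"
    if z: "z \<in> tube_closure" and nz: "norm (z $ j0) > 0" for z
  proof -
    have Q0: "Q z > 0" using Q1[OF z] by simp
    have "norm z ^ N * norm (f z * damping (Suc N) r (z + c)) \<le> (L * Q z) ^ N * (B * (1 / Q z ^ Suc N))"
      unfolding norm_mult norm_damping q_def[symmetric] Q_def[symmetric]
      using B[OF z] Q0 zQ[OF z] B0 L0 by (intro mult_mono power_mono) auto
    also have "\<dots> = L ^ N * B * (1 / Q z)" using Q0 by (simp add: power_mult_distrib)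
    also have "1 / Q z \<le> l j0 / norm (z $ j0)" using zq[OF z, of j0] nz Q0 by (simp add: field_simps)
    finally show ?thesis using L0 B0 by (simp add: mult_left_mono)
  qed
  have lim: "filterlim (\<lambda>z :: complex ^ 'n. norm (z $ j0)) at_top at_infty_tube"
  proof (rule filterlim_mono[OF filterlim_filtercomap order_refl])
    show "at_infty_tube \<le> filtercomap (\<lambda>z :: complex ^ 'n. norm (z $ j0)) at_top"
      unfolding at_infty_tube_def by (intro le_infI1 INF_lower) auto
  qed
  have "((\<lambda>z. L ^ N * B * l j0 / norm (z $ j0)) \<longlongrightarrow> 0) at_infty_tube"
    by (rule tendsto_divide_0[OF tendsto_const filterlim_at_top_imp_at_infinity[OF lim]])
  moreover have "\<forall>\<^sub>F z in at_infty_tube. z \<in> (tube_closure :: (complex ^ 'n) set)"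
    unfolding at_infty_tube_def by (simp add: eventually_inf_principal)
  moreover have "\<forall>\<^sub>F z in at_infty_tube. norm ((z :: complex ^ 'n) $ j0) > 0"
    using lim unfolding filterlim_at_top_dense by blast
  ultimately show ?thesis
  proof (intro Lim_null_comparison[of "\<lambda>z. norm z ^ N * norm (f z * damping (Suc N) r (z + c))"])
    assume "\<forall>\<^sub>F z in at_infty_tube. z \<in> (tube_closure :: (complex ^ 'n) set)"
      "\<forall>\<^sub>F z in at_infty_tube. norm ((z :: complex ^ 'n) $ j0) > 0"
    then show "\<forall>\<^sub>F z in at_infty_tube. norm (norm z ^ N * norm (f z * damping (Suc N) r (z + c))) \<le> L ^ N * B * l j0 / norm (z $ j0)"
      by eventually_elim (use bound in simp)
  qed
qed

theorem theorem4p1: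
  fixes N :: nat and p :: real
  assumes "N > 0" and "0 < p" and "p * real N > 1"
  shows "\<forall>F \<in> (Hp p :: (complex ^ 'n \<Rightarrow> complex) set). \<forall>\<epsilon>>0.
           \<exists>G \<in> wN p N. Hp_norm p (\<lambda>z. F z - G z) < ennreal \<epsilon>"
proof (intro ballI allI impI)
  fix F :: "complex ^ 'n \<Rightarrow> complex" and \<epsilon> :: real
  assume F: "F \<in> Hp p" and eps: "\<epsilon> > 0"
  note p = \<open>0 < p\<close>
  \<comment> \<open>Two errors of size \<open>\<kappa>\<close> under the quasi-triangle constant
    \<open>2 powr p\<close> add up to \<open>(\<epsilon> / 2) powr p\<close>. Halving
    \<open>\<epsilon>\<close> keeps the final inequality strict after the supremum over
    heights.\<close>
  define \<kappa> where "\<kappa> = (\<epsilon> / 2) powr p / (2 * 2 powr p)"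
  have kap: "\<kappa> > 0" using eps by (simp add: \<kappa>_def)
  have hF: "holo_on F tube" using F Hp_iff[OF p] by blast
  obtain s d where d: "d \<in> octant" and sh: "\<And>y. y \<in> octant \<Longrightarrow> p_integral p (\<lambda>z. F z - F (z + cpt s d)) y \<le> ennreal \<kappa>"
    using Hp_shift_approximation[OF p F kap] by blast
  define c where "c = cpt s d"
  have d0: "d $ j \<ge> 0" for j using d by (simp add: octant_def less_imp_le)
  define W :: "nat \<Rightarrow> complex ^ 'n \<Rightarrow> complex" where "W k = damping (Suc N) (1 / (real k + 1))" for k
  have hW: "holo_on (W k) tube" for k unfolding W_def by (rule holo_on_damping) simp
  have W1: "norm (W k z) \<le> 1" if "z \<in> tube" for k z unfolding W_def by (rule norm_damping_le_1[OF that]) simp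
  \<comment> \<open>As damping precedes the shift, \<open>F z - G z\<close> is
    \<open>F z - F (z + c)\<close> plus \<open>R k (z + c)\<close>. Every slice of the second term
    lies above height \<open>d\<close>, so monotonicity reduces it to the single slice of
    \<open>R k\<close> at \<open>d\<close>.\<close>
  define R where "R k z = F z * (1 - W k z)" for k z
  have hR: "holo_on (R k) tube" for k unfolding R_def by (intro holo_on_mult holo_on_diff hF hW holo_on_const)
  have RH: "R k \<in> Hp p" for k unfolding R_def
  proof (rule Hp_mult_bounded[OF p F, where B=2])
    show "norm (1 - W k z) \<le> 2" if "z \<in> tube" for z
      using norm_triangle_ineq4[of 1 "W k z"] W1[OF that, of k] by simp
  qed (intro holo_on_diff hW holo_on_const)
  have "(\<lambda>k. p_integral p (R k) d) \<longlonglongrightarrow> (\<integral>\<^sup>+x. 0 \<partial>(lborel :: (real ^ 'n) measure))"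
    unfolding p_integral_def
  proof (rule nn_integral_dominated_convergence[where w="\<lambda>x. ennreal (2 powr p) * ennreal (norm (F (cpt x d)) powr p)"])
    have m [measurable]: "(\<lambda>x. F (cpt x d)) \<in> borel_measurable borel"
      by (rule tube_measurable[OF hF]) (use d in auto)
    have m' [measurable]: "(\<lambda>x. R k (cpt x d)) \<in> borel_measurable borel" for k
      by (rule tube_measurable[OF hR]) (use d in auto)
    show "(\<lambda>x. ennreal (2 powr p) * ennreal (norm (F (cpt x d)) powr p)) \<in> borel_measurable lborel" by measurable
    show "(\<lambda>x. ennreal (norm (R k (cpt x d)) powr p)) \<in> borel_measurable lborel" for k by measurable
    show "AE x in lborel. ennreal (norm (R k (cpt x d)) powr p) \<le> ennreal (2 powr p) * ennreal (norm (F (cpt x d)) powr p)" for k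
    proof (rule AE_I2)
      fix x
      have "norm (1 - W k (cpt x d)) \<le> 2"
        using norm_triangle_ineq4[of 1 "W k (cpt x d)"] W1[of "cpt x d" k] d by simp
      then have "norm (1 - W k (cpt x d)) powr p \<le> 2 powr p" using p by (intro powr_mono2) auto
      then have "norm (R k (cpt x d)) powr p \<le> norm (F (cpt x d)) powr p * 2 powr p"
        by (simp add: R_def norm_mult powr_mult mult_left_mono)
      then show "ennreal (norm (R k (cpt x d)) powr p) \<le> ennreal (2 powr p) * ennreal (norm (F (cpt x d)) powr p)"
        by (simp add: ennreal_mult[symmetric] ennreal_leI mult.commute)
    qed
    have "p_integral p F d < \<infinity>"
    proof -
      obtain K where "\<forall>y\<in>octant. p_integral p F y \<le> ennreal K" using F Hp_iff[OF p] by blast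
      then have "p_integral p F d \<le> ennreal K" using d by blast
      also have "\<dots> < \<infinity>" by simp
      finally show ?thesis .
    qed
    then show "(\<integral>\<^sup>+x. ennreal (2 powr p) * ennreal (norm (F (cpt x d)) powr p) \<partial>lborel) < \<infinity>"
      unfolding p_integral_def by (simp add: nn_integral_cmult ennreal_mult_less_top)
    show "AE x in lborel. (\<lambda>k. ennreal (norm (R k (cpt x d)) powr p)) \<longlonglongrightarrow> 0"
    proof (rule AE_I2)
      fix x
      have "(\<lambda>k. R k (cpt x d)) \<longlonglongrightarrow> F (cpt x d) * (1 - 1)"
        unfolding R_def W_def by (intro tendsto_intros damping_tendsto_1)
      then show "(\<lambda>k. ennreal (norm (R k (cpt x d)) powr p)) \<longlonglongrightarrow> 0"
        using tendsto_norm_powr_ennreal[OF p, of "\<lambda>k. R k (cpt x d)" 0] p by simp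
    qed
  qed auto
  then have "(\<lambda>k. p_integral p (R k) d) \<longlonglongrightarrow> 0" by simp
  then have "\<forall>\<^sub>F k in sequentially. p_integral p (R k) d < ennreal \<kappa>" using kap by (intro order_tendstoD) auto
  then obtain k where k: "p_integral p (R k) d < ennreal \<kappa>" by (auto simp: eventually_sequentially)
  define G where "G z = F (z + c) * W k (z + c)" for z
  have FW: "(\<lambda>z. F z * W k z) \<in> Hp p" by (rule Hp_mult_bounded[OF p F hW W1])
  have GH: "G \<in> Hp p" unfolding G_def c_def by (rule Hp_translate[OF p FW d0])
  have cc: "z + c \<in> tube" if "z \<in> tube_closure" for z
    using that d by (auto simp: tube_def tube_closure_def c_def octant_def add_nonneg_pos)
  \<comment> \<open>\<open>G\<close> is holomorphic on the tube translated by \<open>- c\<close>, an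
    open set containing the closed tube.\<close>
  have "smooth_on tube_closure G"
  proof (rule holo_on_imp_smooth_on)
    show "open ((\<lambda>z. z + c) -` tube)" by (intro open_vimage open_tube continuous_intros)
    show "holo_on G ((\<lambda>z. z + c) -` tube)" unfolding G_def
      by (rule holo_on_translate[OF holo_on_mult[OF hF hW]]) auto
    show "tube_closure \<subseteq> (\<lambda>z. z + c) -` tube" using cc by auto
  qed
  moreover have "((\<lambda>z. norm z ^ N * norm (G z)) \<longlongrightarrow> 0) at_infty_tube"
  proof -
    \<comment> \<open>The shift keeps \<open>z + c\<close> at a fixed distance from the boundary
      even when \<open>z\<close> lies on it, so \<open>F (z + c)\<close> is bounded on the closed
      tube.\<close>
    define a where "a = Min (range (\<lambda>j. d $ j)) / 2"
    have a0: "a > 0" using d unfolding a_def octant_def by (subst half_gt_zero_iff, subst Min_gr_iff) auto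
    have ad: "2 * a \<le> d $ j" for j by (simp add: a_def)
    obtain B where B: "\<And>z. (\<forall>j. Im (z $ j) \<ge> 2 * a) \<Longrightarrow> norm (F z) \<le> B"
      using Hp_bounded[OF p F a0] by blast
    have "norm (F (z + c)) \<le> B" if "z \<in> tube_closure" for z
      using that ad by (intro B) (auto simp: tube_closure_def c_def add_increasing)
    then show ?thesis unfolding G_def W_def
      by (intro damping_decay) (auto simp: c_def d0)
  qed
  ultimately have "G \<in> wN p N" using GH by (simp add: wN_def)
  moreover have "Hp_norm p (\<lambda>z. F z - G z) < ennreal \<epsilon>"
  proof -
    have eq: "(\<lambda>z. F z - G z) = (\<lambda>z. (F z - F (z + cpt s d)) + R k (z + cpt s d))"
      by (simp add: G_def R_def c_def fun_eq_iff algebra_simps)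
    have "p_integral p (\<lambda>z. F z - G z) y \<le> ennreal ((\<epsilon> / 2) powr p)" if y: "y \<in> octant" for y
    proof -
      have "p_integral p (\<lambda>z. R k (z + cpt s d)) y = p_integral p (R k) (d + y)"
        using p_integral_translate[OF hR octant_add[OF y d0], of p k s] by (simp add: add.commute)
      also have "\<dots> \<le> p_integral p (R k) d"
        using y by (intro p_integral_antimono[OF p RH d]) (auto simp: octant_def less_imp_le)
      finally have 2: "p_integral p (\<lambda>z. R k (z + cpt s d)) y \<le> ennreal \<kappa>" using k by simp
      have "p_integral p (\<lambda>z. F z - G z) y \<le> ennreal (2 powr p) * (p_integral p (\<lambda>z. F z - F (z + cpt s d)) y + p_integral p (\<lambda>z. R k (z + cpt s d)) y)"
        unfolding eq by (intro p_integral_add_le p holo_on_diff holo_on_translate_tube hF hR d0 y)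
      also have "\<dots> \<le> ennreal (2 powr p) * (ennreal \<kappa> + ennreal \<kappa>)"
        by (intro mult_left_mono add_mono sh[OF y] 2) auto
      also have "\<dots> = ennreal ((\<epsilon> / 2) powr p)"
        using kap by (simp add: ennreal_mult[symmetric] ennreal_plus[symmetric] del: ennreal_plus) (simp add: \<kappa>_def)
      finally show ?thesis .
    qed
    then have "Hp_norm p (\<lambda>z. F z - G z) \<le> ennreal (((\<epsilon> / 2) powr p) powr (1 / p))"
      by (intro Hp_norm_le p) auto
    also have "\<dots> = ennreal (\<epsilon> / 2)" using p eps by (simp add: powr_powr)
    also have "\<dots> < ennreal \<epsilon>" using eps by (intro ennreal_lessI) auto
    finally show ?thesis .
  qed
  ultimately show "\<exists>G \<in> wN p N. Hp_norm p (\<lambda>z. F z - G z) < ennreal \<epsilon>" by blast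
qed

end
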